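(* Let $\bm\xi=(\bm\xi_\ell)_{\ell\in\mathbb{N}}$, $\nu$, $\mu$ satisfy the assumptions listed in the context. Let $g:\mathbb{R}_+^2\to\mathbb{R}_+$ be a bounded, measurable function, and define $\tilde g:\mathbb{R}_+^2\to\mathbb{R}$ by $\tilde g(x,y):=g(x,y)-\mathbb{E}[g(\bm V,y)]$. Then the quantity $$\rho_g^2:=\mathbb{E}\left[\tilde g(\bm V,\bm U)^2\right]+2\sum_{k=1}^\infty\mathbb{E}\left[\tilde g(\bm\xi_1,\bm U)\,\tilde g(\bm\xi_{1+k},\bm U')\right]$$ is finite. Moreover, for $\mu^{\mathbb{N}}$-almost every sequence $(s_i)_{i\in\mathbb{N}}\in\mathbb{R}_+^{\mathbb{N}}$, the following convergence in distribution holds as $n\to\infty$: $$\frac{\sum_{j=1}^{2n-1}\tilde g\left(\bm\xi_j,s_j\right)}{\sqrt{2n}}\xrightarrow{d}\mathcal{N}(0,\rho_g^2).$$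
   Context: Notation: $\mathbb{N}=\{1,2,\dots\}$, $\mathbb{R}_+=[0,\infty)$. Random quantities are in bold. $\mathcal{N}(0,v)$ is the centered Gaussian law with variance $v$. $\mu$ and $\nu$ are Borel probability measures on $\mathbb{R}_+$. $\bm V$ has law $\nu$; $\bm U,\bm U'$ have law $\mu$; $\bm V,\bm U,\bm U'$ are independent, and $\bm U,\bm U'$ are independent of $\bm\xi$. Assumptions on $\bm\xi$: $\bm\xi=(\bm\xi_\ell)_{\ell\in\mathbb{N}}$ is an $\mathbb{R}_+$-valued process such that each $\bm\xi_\ell$ has law $\nu$, and $(\bm\xi_\ell,\bm\xi_k)\stackrel{d}{=}(\bm\xi_{\ell+\tau},\bm\xi_{k+\tau})$ for all $\ell,k,\tau\in\mathbb{N}$. Let $\mathcal{A}_1^k=\sigma(\bm\xi_1,\dots,\bm\xi_k)$, $\mathcal{A}_k^\infty=\sigma(\bm\xi_k,\bm\xi_{k+1},\dots)$ and $$\alpha_n=\sup_{k\in\mathbb{N},\,A\in\mathcal{A}_1^k,\,B\in\mathcal{A}_{k+n}^\infty}|\mathbb{P}(A\cap B)-\mathbb{P}(A)\mathbb{P}(B)|.$$ It is assumed that $\sum_{n=1}^\infty\alpha_n<\infty$ and that there exist two sequences $p=p(n)$, $q=q(n)$ of positive integers such that, as $n\to\infty$: $p\to+\infty$ and $q\to+\infty$; $q=o(p)$ and $p=o(n)$; $np^{-1}\alpha_q=o(1)$; $\frac{p}{n}\sum_{j=1}^p j\alpha_j=o(1)$. *)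

theory Defs
  imports "HOL-Probability.Probability" "HOL-Library.Landau_Symbols"
begin

abbreviation Rplus :: "real measure" where
  "Rplus \<equiv> restrict_space borel {0..}"

definition generated_sigma ::
    "'a measure \<Rightarrow> (nat \<Rightarrow> 'a \<Rightarrow> real) \<Rightarrow> nat set \<Rightarrow> 'a set set" where
  "generated_sigma M \<xi> I =
     sigma_sets (space M) (\<Union>l\<in>I. {\<xi> l -` B \<inter> space M | B. B \<in> sets Rplus})"

text \<open>Processes are indexed by the positive integers; the value of \<open>\<xi>\<close> at index 0 is never used.\<close>

definition mixing_coeff :: "'a measure \<Rightarrow> (nat \<Rightarrow> 'a \<Rightarrow> real) \<Rightarrow> nat \<Rightarrow> real" where
  "mixing_coeff M \<xi> n =
     Sup {\<bar>measure M (A \<inter> B) - measure M A * measure M B\<bar> | k A B.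
            k \<ge> 1 \<and> A \<in> generated_sigma M \<xi> {1..k} \<and> B \<in> generated_sigma M \<xi> {k + n..}}"

definition centred ::
    "'a measure \<Rightarrow> ('a \<Rightarrow> real) \<Rightarrow> (real \<Rightarrow> real \<Rightarrow> real) \<Rightarrow> real \<Rightarrow> real \<Rightarrow> real" where
  "centred M V g x y = g x y - (\<integral>\<omega>. g (V \<omega>) y \<partial>M)"

text \<open>\<open>rho_cov M V U U' \<xi> g k\<close> is the \<open>k\<close>-th covariance in the series defining \<open>rho_sq\<close>. That
  series starts at \<open>k = 1\<close>, hence the shift by \<open>Suc\<close>.\<close>

definition rho_cov ::
    "'a measure \<Rightarrow> ('a \<Rightarrow> real) \<Rightarrow> ('a \<Rightarrow> real) \<Rightarrow> ('a \<Rightarrow> real) \<Rightarrow> (nat \<Rightarrow> 'a \<Rightarrow> real) \<Rightarrow>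
     (real \<Rightarrow> real \<Rightarrow> real) \<Rightarrow> nat \<Rightarrow> real" where
  "rho_cov M V U U' \<xi> g k =
     (\<integral>\<omega>. centred M V g (\<xi> 1 \<omega>) (U \<omega>) * centred M V g (\<xi> (1 + k) \<omega>) (U' \<omega>) \<partial>M)"

definition rho_sq ::
    "'a measure \<Rightarrow> ('a \<Rightarrow> real) \<Rightarrow> ('a \<Rightarrow> real) \<Rightarrow> ('a \<Rightarrow> real) \<Rightarrow> (nat \<Rightarrow> 'a \<Rightarrow> real) \<Rightarrow>
     (real \<Rightarrow> real \<Rightarrow> real) \<Rightarrow> real" where
  "rho_sq M V U U' \<xi> g =
     (\<integral>\<omega>. (centred M V g (V \<omega>) (U \<omega>))\<^sup>2 \<partial>M) + 2 * (\<Sum>k. rho_cov M V U U' \<xi> g (Suc k))"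

text \<open>For variance 0 the centred Gaussian law is the point mass at 0. The parameter is the
  variance \<open>v \<ge> 0\<close>, whereas \<open>normal_density\<close> expects the standard deviation.\<close>

definition centred_gaussian :: "real \<Rightarrow> real measure" where
  "centred_gaussian v =
     (if v = 0 then return borel 0 else density lborel (normal_density 0 (sqrt v)))"

end

(* Put X_j = g~(xi_j, s_j) for a fixed sample s.  This is a bounded, centred, strongly mixing sequence,
   and it suffices that the characteristic function f of S / sqrt N, S = sum of X_j over j < N,
   satisfies f'(t) = - t v f(t) + o(1) with v = lim Var(S) / N (Bolthausen's variant of Stein's
   method).  Differentiation produces the terms E[X_j exp(itS / sqrt N)].  Remove from S the window
   W_j of the summands X_i with |i - j| <= m, where m is a small multiple of sqrt N: mixing makes
   the remaining expectation negligible, and the first-order correction is governed by the sum of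
   X_j W_j, whose variance is O(N m^2).  The limit v = rho^2 of the normalised variances holds for
   almost every s: apply, for each lag k, a strong law to the covariances c_k(s_i, s_{i+k}), and sum
   over k by Tannery's theorem with a multiple of alpha_k as majorant. *)
theory Submission
  imports Defs
begin

text \<open>The window is squeezed from both sides. What lies outside it costs
  \<open>sqrt N * \<alpha> (Suc m)\<close>; a decreasing summable sequence satisfies n \<alpha>(n)
  -> 0, so this vanishes once m is at least a fixed multiple of sqrt N. The fluctuations of the sum
  of the X_j W_j cost m / sqrt N, so m = \<delta> sqrt N leaves an error of order \<delta> that does
  not tend to 0: \<delta> has to be fixed from the desired accuracy before N grows. At this scale
  the pointwise bound W_j = O(m) is too weak: it would replace the variance N m^2 by N m^3, and the
  second-order remainder m / sqrt N by m^2 / sqrt N. Both are saved by E[W_j^2] = O(m), a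
  consequence of summable covariances. For fixed s the sequence X_j need not be stationary, so the
  limit of the variances is a hypothesis of the limit theorem and is established separately. There,
  c_k(s_i, s_{i+k}) and c_k(s_j, s_{j+k}) are independent when i and j are more than k apart, so a
  second-moment strong law suffices, and the lags contribute only countably many null sets.\<close>

section \<open>The covariance inequality for strongly mixing sigma-algebras\<close>

text \<open>The maximum of \<open>E[X Z]\<close> over such \<open>X\<close> is attained at the indicator of \<open>{E[Z | A] > 0}\<close>.\<close>

lemma (in prob_space) integral_mult_le_of_indicator:
  fixes X Z :: "'a \<Rightarrow> real"
  assumes A: "subalgebra M A"
    and X: "X \<in> borel_measurable A" "\<And>\<omega>. \<omega> \<in> space M \<Longrightarrow> 0 \<le> X \<omega> \<and> X \<omega> \<le> 1"
    and Z: "integrable M Z"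
    and le: "\<And>S. S \<in> sets A \<Longrightarrow> (\<integral>\<omega>. indicator S \<omega> * Z \<omega> \<partial>M) \<le> c"
  shows "(\<integral>\<omega>. X \<omega> * Z \<omega> \<partial>M) \<le> c"
proof -
  interpret finite_measure_subalgebra M A
    by unfold_locales (rule A)
  define C where "C = real_cond_exp M A Z"
  define S where "S = {\<omega>\<in>space A. 0 < C \<omega>}"
  have CA[measurable]: "C \<in> borel_measurable A" and [measurable]: "C \<in> borel_measurable M"
    by (auto simp: C_def)
  have S: "S \<in> sets A"
    unfolding S_def by measurable
  have XM[measurable]: "X \<in> borel_measurable M"
    using measurable_from_subalg[OF A] X(1) by blast
  have SM[measurable]: "S \<in> sets M"
    using A S by (auto simp: subalgebra_def)
  have ZM[measurable]: "Z \<in> borel_measurable M"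
    using Z by simp
  have C: "integrable M C"
    unfolding C_def by (rule real_cond_exp_int(1)[OF Z])
  have iX: "integrable M (\<lambda>\<omega>. X \<omega> * W \<omega>)" if "integrable M W" for W
    using X(2) that
    by (intro Bochner_Integration.integrable_bound[OF that] AE_I2) (auto simp: abs_mult mult_left_le_one_le)
  have iS: "integrable M (\<lambda>\<omega>. indicator S \<omega> * W \<omega>)" if "integrable M W" for W :: "'a \<Rightarrow> real"
    using that by (intro Bochner_Integration.integrable_bound[OF that] AE_I2) (auto simp: abs_mult indicator_def)
  have "(\<integral>\<omega>. X \<omega> * Z \<omega> \<partial>M) = (\<integral>\<omega>. X \<omega> * C \<omega> \<partial>M)"
    unfolding C_def using real_cond_exp_intg(2)[OF iX[OF Z] X(1)] by simp
  also have "\<dots> \<le> (\<integral>\<omega>. indicator S \<omega> * C \<omega> \<partial>M)"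
  proof (intro integral_mono iX iS C)
    fix \<omega> assume "\<omega> \<in> space M"
    then have "0 \<le> X \<omega>" "X \<omega> \<le> 1" "\<omega> \<in> space A"
      using X(2) A by (auto simp: subalgebra_def)
    then show "X \<omega> * C \<omega> \<le> indicator S \<omega> * C \<omega>"
      by (cases "0 < C \<omega>") (auto simp: S_def indicator_def mult_left_le_one_le mult_nonneg_nonpos)
  qed
  also have "\<dots> = (\<integral>\<omega>. indicator S \<omega> * Z \<omega> \<partial>M)"
    unfolding C_def using S by (intro real_cond_exp_intg(2)[OF iS[OF Z]]) auto
  also have "\<dots> \<le> c"
    by (rule le[OF S])
  finally show ?thesis .
qed

lemma (in prob_space) abs_integral_mult_le_of_indicator:
  fixes X Z :: "'a \<Rightarrow> real"
  assumes A: "subalgebra M A"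
    and X: "X \<in> borel_measurable A" "\<And>\<omega>. \<omega> \<in> space M \<Longrightarrow> 0 \<le> X \<omega> \<and> X \<omega> \<le> 1"
    and Z: "integrable M Z"
    and le: "\<And>S. S \<in> sets A \<Longrightarrow> \<bar>\<integral>\<omega>. indicator S \<omega> * Z \<omega> \<partial>M\<bar> \<le> c"
  shows "\<bar>\<integral>\<omega>. X \<omega> * Z \<omega> \<partial>M\<bar> \<le> c"
proof -
  have "(\<integral>\<omega>. X \<omega> * Z \<omega> \<partial>M) \<le> c"
    using le by (intro integral_mult_le_of_indicator[OF A X Z]) (auto dest: abs_le_D1)
  moreover have "(\<integral>\<omega>. X \<omega> * - Z \<omega> \<partial>M) \<le> c"
    using le Z by (intro integral_mult_le_of_indicator[OF A X]) (auto dest: abs_le_D2)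
  ultimately show ?thesis
    by auto
qed

text \<open>An upper bound for Rosenblatt's strong mixing coefficient of two sigma-algebras, with
  the inclusions in \<open>M\<close> bundled in.\<close>

definition (in prob_space) mixing_le :: "'a measure \<Rightarrow> 'a measure \<Rightarrow> real \<Rightarrow> bool" where
  "mixing_le A B c \<longleftrightarrow> subalgebra M A \<and> subalgebra M B \<and>
     (\<forall>S\<in>sets A. \<forall>T\<in>sets B. \<bar>prob (S \<inter> T) - prob S * prob T\<bar> \<le> c)"

lemma (in prob_space) mixing_le_nonneg: "mixing_le A B c \<Longrightarrow> 0 \<le> c"
  unfolding mixing_le_def by (meson abs_ge_zero order_trans sets.empty_sets)

text \<open>For fixed \<open>Y\<close> the covariance is linear in \<open>X\<close>, so it is
  extremal at indicators of events of \<open>A\<close>; for such an indicator it is linear in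
  \<open>Y\<close>, hence extremal at indicators of events of \<open>B\<close>. On a pair of
  indicators it is the mixing hypothesis.\<close>

lemma (in prob_space) covariance_le_unit:
  fixes X Y :: "'a \<Rightarrow> real"
  assumes mix: "mixing_le A B c"
    and X: "X \<in> borel_measurable A" "\<And>\<omega>. \<omega> \<in> space M \<Longrightarrow> 0 \<le> X \<omega> \<and> X \<omega> \<le> 1"
    and Y: "Y \<in> borel_measurable B" "\<And>\<omega>. \<omega> \<in> space M \<Longrightarrow> 0 \<le> Y \<omega> \<and> Y \<omega> \<le> 1"
  shows "\<bar>(\<integral>\<omega>. X \<omega> * Y \<omega> \<partial>M) - (\<integral>\<omega>. X \<omega> \<partial>M) * (\<integral>\<omega>. Y \<omega> \<partial>M)\<bar> \<le> c"
proof -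
  have A: "subalgebra M A" and B: "subalgebra M B"
    using mix by (auto simp: mixing_le_def)
  have XM[measurable]: "X \<in> borel_measurable M" and YM[measurable]: "Y \<in> borel_measurable M"
    using measurable_from_subalg[OF A X(1)] measurable_from_subalg[OF B Y(1)] by auto
  have iX: "integrable M X" and iY: "integrable M Y"
    using X(2) Y(2) by (auto intro!: integrable_const_bound[where B=1] AE_I2)
  have [simp]: "integrable M (indicator T :: 'a \<Rightarrow> real)" if "T \<in> sets M" for T
    using that by (intro integrable_real_indicator) (auto simp: less_top[symmetric])
  have iXY: "integrable M (\<lambda>\<omega>. X \<omega> * Y \<omega>)"
    using X(2) Y(2) by (auto intro!: integrable_const_bound[where B=1] AE_I2 mult_le_one simp: abs_mult)
  have "\<bar>\<integral>\<omega>. X \<omega> * (Y \<omega> - expectation Y) \<partial>M\<bar> \<le> c"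
  proof (rule abs_integral_mult_le_of_indicator[OF A X])
    show "integrable M (\<lambda>\<omega>. Y \<omega> - expectation Y)"
      using iY by auto
    fix S assume S: "S \<in> sets A"
    then have SM[measurable]: "S \<in> sets M"
      using A by (auto simp: subalgebra_def)
    have iSY: "integrable M (\<lambda>\<omega>. indicator S \<omega> * Y \<omega>)"
      by (auto intro!: Bochner_Integration.integrable_bound[OF iY] AE_I2 simp: abs_mult indicator_def)
    \<comment> \<open>The centring moves from \<open>Y\<close> to the indicator: both products
      integrate to E[1_S Y] - P(S) E[Y], and the new one is linear in the uncentred
      \<open>Y\<close>.\<close>
    have "\<bar>\<integral>\<omega>. Y \<omega> * (indicator S \<omega> - prob S) \<partial>M\<bar> \<le> c"
    proof (rule abs_integral_mult_le_of_indicator[OF B Y])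
      show "integrable M (\<lambda>\<omega>. indicator S \<omega> - prob S)"
        by simp
      fix T assume T: "T \<in> sets B"
      then have TM[measurable]: "T \<in> sets M"
        using B by (auto simp: subalgebra_def)
      have "(\<integral>\<omega>. indicator T \<omega> * (indicator S \<omega> - prob S) \<partial>M)
          = (\<integral>\<omega>. indicator (S \<inter> T) \<omega> - prob S * indicator T \<omega> \<partial>M)"
        by (intro Bochner_Integration.integral_cong) (auto simp: indicator_def)
      also have "\<dots> = prob (S \<inter> T) - prob S * prob T"
        by (subst Bochner_Integration.integral_diff) auto
      finally show "\<bar>\<integral>\<omega>. indicator T \<omega> * (indicator S \<omega> - prob S) \<partial>M\<bar> \<le> c"
        using mix S T by (simp add: mixing_le_def)
    qed
    moreover have "(\<integral>\<omega>. Y \<omega> * (indicator S \<omega> - prob S) \<partial>M)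
        = (\<integral>\<omega>. indicator S \<omega> * Y \<omega> \<partial>M) - expectation Y * prob S"
      using iSY iY by (simp add: right_diff_distrib mult.commute)
    moreover have "(\<integral>\<omega>. indicator S \<omega> * (Y \<omega> - expectation Y) \<partial>M)
        = (\<integral>\<omega>. indicator S \<omega> * Y \<omega> \<partial>M) - expectation Y * prob S"
      using iSY by (simp add: right_diff_distrib mult.commute)
    ultimately show "\<bar>\<integral>\<omega>. indicator S \<omega> * (Y \<omega> - expectation Y) \<partial>M\<bar> \<le> c"
      by simp
  qed
  then show ?thesis
    using iX iXY by (simp add: right_diff_distrib)
qed

text \<open>The affine maps \<open>X'\<close> and \<open>Y'\<close> carry [-a, a] and [-b, b] onto
  the unit interval. Covariance ignores the shifts and is scaled by 1 / (4ab), which is the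
  constant. Vanishing bounds are treated apart because of the division.\<close>

lemma (in prob_space) covariance_le:
  fixes X Y :: "'a \<Rightarrow> real"
  assumes mix: "mixing_le A B c"
    and X: "X \<in> borel_measurable A" "\<And>\<omega>. \<omega> \<in> space M \<Longrightarrow> \<bar>X \<omega>\<bar> \<le> a"
    and Y: "Y \<in> borel_measurable B" "\<And>\<omega>. \<omega> \<in> space M \<Longrightarrow> \<bar>Y \<omega>\<bar> \<le> b"
    and ab: "0 \<le> a" "0 \<le> b"
  shows "\<bar>(\<integral>\<omega>. X \<omega> * Y \<omega> \<partial>M) - (\<integral>\<omega>. X \<omega> \<partial>M) * (\<integral>\<omega>. Y \<omega> \<partial>M)\<bar> \<le> 4 * a * b * c"
proof (cases "a = 0 \<or> b = 0")
  case True
  then have "(\<integral>\<omega>. X \<omega> * Y \<omega> \<partial>M) = 0" "(\<integral>\<omega>. X \<omega> \<partial>M) * (\<integral>\<omega>. Y \<omega> \<partial>M) = 0"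
    using X(2) Y(2) by (auto intro!: integral_eq_zero_AE AE_I2)
  then show ?thesis
    using True by auto
next
  case False
  then have pos: "a > 0" "b > 0"
    using ab by auto
  have A: "subalgebra M A" and B: "subalgebra M B"
    using mix by (auto simp: mixing_le_def)
  have XM[measurable]: "X \<in> borel_measurable M" and YM[measurable]: "Y \<in> borel_measurable M"
    using measurable_from_subalg[OF A X(1)] measurable_from_subalg[OF B Y(1)] by auto
  have [simp]: "integrable M X" "integrable M Y"
    using X(2) Y(2) by (auto intro!: integrable_const_bound AE_I2)
  have [simp]: "integrable M (\<lambda>\<omega>. X \<omega> * Y \<omega>)"
    using X(2) Y(2) ab by (auto intro!: integrable_const_bound[where B="a * b"] AE_I2 mult_mono simp: abs_mult)
  define X' Y' where "X' \<omega> = (X \<omega> + a) / (2 * a)" and "Y' \<omega> = (Y \<omega> + b) / (2 * b)" for \<omega>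
  have "\<bar>(\<integral>\<omega>. X' \<omega> * Y' \<omega> \<partial>M) - (\<integral>\<omega>. X' \<omega> \<partial>M) * (\<integral>\<omega>. Y' \<omega> \<partial>M)\<bar> \<le> c"
    using X Y pos unfolding X'_def Y'_def
    by (intro covariance_le_unit[OF mix]) (auto simp: field_simps abs_le_iff, (smt (verit))+)
  moreover have "(\<integral>\<omega>. X' \<omega> \<partial>M) = ((\<integral>\<omega>. X \<omega> \<partial>M) + a) / (2 * a)"
    by (simp add: X'_def prob_space)
  moreover have "(\<integral>\<omega>. Y' \<omega> \<partial>M) = ((\<integral>\<omega>. Y \<omega> \<partial>M) + b) / (2 * b)"
    by (simp add: Y'_def prob_space)
  moreover have "(\<integral>\<omega>. X' \<omega> * Y' \<omega> \<partial>M)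
      = ((\<integral>\<omega>. X \<omega> * Y \<omega> \<partial>M) + b * (\<integral>\<omega>. X \<omega> \<partial>M) + a * (\<integral>\<omega>. Y \<omega> \<partial>M) + a * b) / (4 * a * b)"
  proof -
    have "(\<integral>\<omega>. X' \<omega> * Y' \<omega> \<partial>M) = (\<integral>\<omega>. (X \<omega> * Y \<omega> + b * X \<omega> + a * Y \<omega> + a * b) / (4 * a * b) \<partial>M)"
      using pos by (intro Bochner_Integration.integral_cong) (auto simp: X'_def Y'_def field_simps)
    then show ?thesis
      by (simp add: prob_space)
  qed
  ultimately have "\<bar>((\<integral>\<omega>. X \<omega> * Y \<omega> \<partial>M) - (\<integral>\<omega>. X \<omega> \<partial>M) * (\<integral>\<omega>. Y \<omega> \<partial>M)) / (4 * a * b)\<bar> \<le> c"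
    using pos by (simp add: divide_simps) (simp add: algebra_simps)
  then show ?thesis
    using pos by (simp add: abs_mult pos_divide_le_eq mult.commute)
qed

text \<open>The real and the imaginary part each combine two real covariances of size at most 4abc;
  adding the moduli of the two parts gives 16.\<close>

lemma (in prob_space) complex_covariance_le:
  fixes X Y :: "'a \<Rightarrow> complex"
  assumes mix: "mixing_le A B c"
    and X: "X \<in> borel_measurable A" "\<And>\<omega>. \<omega> \<in> space M \<Longrightarrow> norm (X \<omega>) \<le> a"
    and Y: "Y \<in> borel_measurable B" "\<And>\<omega>. \<omega> \<in> space M \<Longrightarrow> norm (Y \<omega>) \<le> b"
    and ab: "0 \<le> a" "0 \<le> b"
  shows "norm ((\<integral>\<omega>. X \<omega> * Y \<omega> \<partial>M) - (\<integral>\<omega>. X \<omega> \<partial>M) * (\<integral>\<omega>. Y \<omega> \<partial>M)) \<le> 16 * a * b * c"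
proof -
  define cov where "cov f h = (\<integral>\<omega>. f \<omega> * h \<omega> \<partial>M) - (\<integral>\<omega>. f \<omega> \<partial>M) * (\<integral>\<omega>. h \<omega> \<partial>M)" for f h :: "'a \<Rightarrow> real"
  define X1 X2 Y1 Y2 where "X1 = (\<lambda>\<omega>. Re (X \<omega>))" and "X2 = (\<lambda>\<omega>. Im (X \<omega>))"
    and "Y1 = (\<lambda>\<omega>. Re (Y \<omega>))" and "Y2 = (\<lambda>\<omega>. Im (Y \<omega>))"
  note defs = X1_def X2_def Y1_def Y2_def
  have A: "subalgebra M A" and B: "subalgebra M B"
    using mix by (auto simp: mixing_le_def)
  have XM[measurable]: "X \<in> borel_measurable M" and YM[measurable]: "Y \<in> borel_measurable M"
    using measurable_from_subalg[OF A X(1)] measurable_from_subalg[OF B Y(1)] by auto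
  have mA: "X1 \<in> borel_measurable A" "X2 \<in> borel_measurable A"
    and mB: "Y1 \<in> borel_measurable B" "Y2 \<in> borel_measurable B"
    using X(1) Y(1) unfolding defs by measurable
  have bA: "\<bar>X1 \<omega>\<bar> \<le> a" "\<bar>X2 \<omega>\<bar> \<le> a" and bB: "\<bar>Y1 \<omega>\<bar> \<le> b" "\<bar>Y2 \<omega>\<bar> \<le> b"
    if "\<omega> \<in> space M" for \<omega>
    using X(2)[OF that] Y(2)[OF that] abs_Re_le_cmod abs_Im_le_cmod order_trans unfolding defs by blast+
  have c: "\<bar>cov X1 Y1\<bar> \<le> 4 * a * b * c" "\<bar>cov X1 Y2\<bar> \<le> 4 * a * b * c"
    "\<bar>cov X2 Y1\<bar> \<le> 4 * a * b * c" "\<bar>cov X2 Y2\<bar> \<le> 4 * a * b * c"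
    unfolding cov_def by (intro covariance_le[OF mix] mA mB bA bB ab; assumption)+
  have iX: "integrable M X" and iY: "integrable M Y"
    using X(2) Y(2) by (auto intro!: integrable_const_bound AE_I2)
  have iXY: "integrable M (\<lambda>\<omega>. X \<omega> * Y \<omega>)"
    using X(2) Y(2) ab by (auto intro!: integrable_const_bound[where B="a * b"] AE_I2 mult_mono simp: norm_mult)
  have [measurable]: "X1 \<in> borel_measurable M" "X2 \<in> borel_measurable M" "Y1 \<in> borel_measurable M" "Y2 \<in> borel_measurable M"
    unfolding defs by measurable
  have i: "integrable M (\<lambda>\<omega>. X1 \<omega> * Y1 \<omega>)" "integrable M (\<lambda>\<omega>. X1 \<omega> * Y2 \<omega>)"
    "integrable M (\<lambda>\<omega>. X2 \<omega> * Y1 \<omega>)" "integrable M (\<lambda>\<omega>. X2 \<omega> * Y2 \<omega>)"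
    using bA bB ab by (auto intro!: integrable_const_bound[where B="a * b"] AE_I2 mult_mono simp: abs_mult)
  let ?D = "(\<integral>\<omega>. X \<omega> * Y \<omega> \<partial>M) - (\<integral>\<omega>. X \<omega> \<partial>M) * (\<integral>\<omega>. Y \<omega> \<partial>M)"
  have "Re ?D = cov X1 Y1 - cov X2 Y2"
    using i iX iY iXY by (simp add: cov_def defs algebra_simps flip: integral_Re integral_Im)
  moreover have "Im ?D = cov X1 Y2 + cov X2 Y1"
    using i iX iY iXY by (simp add: cov_def defs algebra_simps flip: integral_Re integral_Im)
  ultimately show ?thesis
    using c cmod_le[of ?D] by simp
qed

section \<open>Windows and second moments of mixing sequences\<close>

text \<open>One of the two truncated differences is 0, so this is the absolute difference, kept in
  the naturals to serve as an index of \<alpha>.\<close>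

definition nat_dist :: "nat \<Rightarrow> nat \<Rightarrow> nat" where
  "nat_dist i j = (i - j) + (j - i)"

lemma nat_dist_commute: "nat_dist i j = nat_dist j i"
  by (simp add: nat_dist_def)

text \<open>On either side of \<open>i\<close> each distance occurs at most once, so each half of
  the sum is dominated by the whole series.\<close>

lemma sum_nat_dist_le_suminf:
  fixes h :: "nat \<Rightarrow> real"
  assumes h: "\<And>d. 0 \<le> h d" "summable h" and J: "finite J"
  shows "(\<Sum>j\<in>J. h (nat_dist i j)) \<le> 2 * suminf h"
proof -
  have "(\<Sum>j\<in>{j\<in>J. j \<le> i}. h (nat_dist i j)) = (\<Sum>d\<in>(\<lambda>j. i - j) ` {j\<in>J. j \<le> i}. h d)"
    by (subst sum.reindex) (auto simp: inj_on_def nat_dist_def intro!: sum.cong)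
  also have "\<dots> \<le> suminf h"
    using J h by (intro sum_le_suminf) auto
  finally have 1: "(\<Sum>j\<in>{j\<in>J. j \<le> i}. h (nat_dist i j)) \<le> suminf h" .
  have "(\<Sum>j\<in>{j\<in>J. \<not> j \<le> i}. h (nat_dist i j)) = (\<Sum>d\<in>(\<lambda>j. j - i) ` {j\<in>J. \<not> j \<le> i}. h d)"
    by (subst sum.reindex) (auto simp: inj_on_def nat_dist_def intro!: sum.cong)
  also have "\<dots> \<le> suminf h"
    using J h by (intro sum_le_suminf) auto
  finally have 2: "(\<Sum>j\<in>{j\<in>J. \<not> j \<le> i}. h (nat_dist i j)) \<le> suminf h" .
  have "(\<Sum>j\<in>J. h (nat_dist i j))
      = (\<Sum>j\<in>{j\<in>J. j \<le> i} \<union> {j\<in>J. \<not> j \<le> i}. h (nat_dist i j))"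
    by (intro sum.cong) auto
  also have "\<dots> = (\<Sum>j\<in>{j\<in>J. j \<le> i}. h (nat_dist i j)) + (\<Sum>j\<in>{j\<in>J. \<not> j \<le> i}. h (nat_dist i j))"
    using J by (intro sum.union_disjoint) auto
  finally show ?thesis
    using 1 2 by simp
qed

lemma card_nat_dist_le: "card {i. i < N \<and> nat_dist i j \<le> m} \<le> 2 * m + 1"
proof -
  have "card {i. i < N \<and> nat_dist i j \<le> m} \<le> card {j - m..j + m}"
    by (intro card_mono) (auto simp: nat_dist_def)
  then show ?thesis
    by simp
qed

section \<open>Elementary second-moment inequalities\<close>

lemma (in prob_space) expectation_power2_centred_le:
  fixes T :: "'a \<Rightarrow> real"
  assumes "integrable M T" "integrable M (\<lambda>\<omega>. (T \<omega>)\<^sup>2)"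
  shows "expectation (\<lambda>\<omega>. (T \<omega> - expectation T)\<^sup>2) \<le> expectation (\<lambda>\<omega>. (T \<omega>)\<^sup>2)"
  using variance_eq[OF assms] by simp

lemma (in prob_space) abs_expectation_mult_le:
  fixes T U :: "'a \<Rightarrow> real"
  assumes "integrable M (\<lambda>\<omega>. T \<omega> * U \<omega>)" "integrable M (\<lambda>\<omega>. (T \<omega>)\<^sup>2)" "integrable M (\<lambda>\<omega>. (U \<omega>)\<^sup>2)"
    and "expectation (\<lambda>\<omega>. (T \<omega>)\<^sup>2) \<le> B" "expectation (\<lambda>\<omega>. (U \<omega>)\<^sup>2) \<le> B"
  shows "\<bar>expectation (\<lambda>\<omega>. T \<omega> * U \<omega>)\<bar> \<le> B"
proof -
  have "\<bar>expectation (\<lambda>\<omega>. T \<omega> * U \<omega>)\<bar> \<le> expectation (\<lambda>\<omega>. \<bar>T \<omega> * U \<omega>\<bar>)"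
    by (rule integral_abs_bound)
  also have "\<dots> \<le> expectation (\<lambda>\<omega>. ((T \<omega>)\<^sup>2 + (U \<omega>)\<^sup>2) / 2)"
  proof (rule integral_mono)
    fix \<omega>
    have "0 \<le> (\<bar>T \<omega>\<bar> - \<bar>U \<omega>\<bar>)\<^sup>2"
      by simp
    then show "\<bar>T \<omega> * U \<omega>\<bar> \<le> ((T \<omega>)\<^sup>2 + (U \<omega>)\<^sup>2) / 2"
      by (simp add: power2_diff abs_mult)
  qed (use assms in auto)
  also have "\<dots> \<le> B"
    using assms by simp
  finally show ?thesis .
qed

lemma (in prob_space) expectation_abs_le_sqrt:
  fixes T :: "'a \<Rightarrow> real"
  assumes "integrable M T" "integrable M (\<lambda>\<omega>. (T \<omega>)\<^sup>2)"
  shows "expectation (\<lambda>\<omega>. \<bar>T \<omega>\<bar>) \<le> sqrt (expectation (\<lambda>\<omega>. (T \<omega>)\<^sup>2))"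
proof -
  have "0 \<le> variance (\<lambda>\<omega>. \<bar>T \<omega>\<bar>)"
    by simp
  also have "variance (\<lambda>\<omega>. \<bar>T \<omega>\<bar>) = expectation (\<lambda>\<omega>. (T \<omega>)\<^sup>2) - (expectation (\<lambda>\<omega>. \<bar>T \<omega>\<bar>))\<^sup>2"
    using assms by (subst variance_eq) auto
  finally show ?thesis
    by (intro real_le_rsqrt) simp
qed

text \<open>Stationarity of \<open>X\<close> is not part of the setting, since fixing the sample
  destroys it. Here \<alpha> may be any decreasing summable sequence that dominates the dependence
  between past and future at gap n.\<close>

locale bounded_mixing_sequence = prob_space M for M :: "'a measure" +
  fixes X :: "nat \<Rightarrow> 'a \<Rightarrow> real" and F :: "nat set \<Rightarrow> 'a measure"
    and \<alpha> :: "nat \<Rightarrow> real" and K :: real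
  assumes subalg: "subalgebra M (F I)"
    and F_mono: "I \<subseteq> J \<Longrightarrow> sets (F I) \<subseteq> sets (F J)"
    and X_F: "X j \<in> borel_measurable (F {j})"
    and X_bound: "\<omega> \<in> space M \<Longrightarrow> \<bar>X j \<omega>\<bar> \<le> K"
    and X_mean: "expectation (X j) = 0"
    and mixing: "mixing_le (F {..k}) (F {k + n..}) (\<alpha> n)"
    and decseq_\<alpha>: "decseq \<alpha>"
    and summable_\<alpha>: "summable \<alpha>"
begin

lemma X_meas_F: "j \<in> I \<Longrightarrow> X j \<in> borel_measurable (F I)"
  using X_F[of j] F_mono[of "{j}" I] subalg[of I] subalg[of "{j}"]
  by (auto simp: measurable_def subalgebra_def)

lemma X_meas[measurable]: "X j \<in> borel_measurable M"
  using measurable_from_subalg[OF subalg X_F] .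

lemma K_nonneg: "0 \<le> K"
  using X_bound not_empty by (meson abs_ge_zero all_not_in_conv order_trans)

lemma \<alpha>_nonneg: "0 \<le> \<alpha> n"
  using mixing_le_nonneg[OF mixing] .

lemma suminf_\<alpha>_nonneg: "0 \<le> suminf \<alpha>"
  using suminf_nonneg[OF summable_\<alpha> \<alpha>_nonneg] .

lemma integrable_bounded:
  fixes f :: "'a \<Rightarrow> 'b :: {banach, second_countable_topology}"
  assumes "f \<in> borel_measurable M" "\<And>\<omega>. \<omega> \<in> space M \<Longrightarrow> norm (f \<omega>) \<le> B"
  shows "integrable M f"
  using assms by (auto intro!: integrable_const_bound AE_I2)

lemma sum_X_bound:
  assumes "\<omega> \<in> space M"
  shows "\<bar>\<Sum>i\<in>I. X i \<omega>\<bar> \<le> real (card I) * K"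
proof -
  have "\<bar>\<Sum>i\<in>I. X i \<omega>\<bar> \<le> (\<Sum>i\<in>I. K)"
    using X_bound[OF assms] by (intro order_trans[OF sum_abs sum_mono]) auto
  then show ?thesis by simp
qed

lemma integrable_XX: "integrable M (\<lambda>\<omega>. X i \<omega> * X j \<omega>)"
  using X_bound K_nonneg
  by (intro integrable_bounded[where B="K * K"]) (auto simp: abs_mult intro!: mult_mono)

lemma covariance_X_le_aux: "i \<le> j \<Longrightarrow> \<bar>expectation (\<lambda>\<omega>. X i \<omega> * X j \<omega>)\<bar> \<le> 4 * K\<^sup>2 * \<alpha> (j - i)"
  using covariance_le[OF mixing[of i "j - i"], of "X i" K "X j" K] K_nonneg X_bound
  by (auto simp: X_meas_F X_mean power2_eq_square)

lemma covariance_X_le: "\<bar>expectation (\<lambda>\<omega>. X i \<omega> * X j \<omega>)\<bar> \<le> 4 * K\<^sup>2 * \<alpha> (nat_dist i j)"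
  using covariance_X_le_aux[of i j] covariance_X_le_aux[of j i]
  by (cases "i \<le> j") (auto simp: nat_dist_def mult.commute)

lemma expectation_sum_mult:
  "finite I \<Longrightarrow> finite J \<Longrightarrow>
    expectation (\<lambda>\<omega>. (\<Sum>i\<in>I. X i \<omega>) * (\<Sum>j\<in>J. X j \<omega>)) = (\<Sum>i\<in>I. \<Sum>j\<in>J. expectation (\<lambda>\<omega>. X i \<omega> * X j \<omega>))"
  by (simp add: sum_product integrable_XX)

text \<open>Every row of the covariance matrix sums to at most 8 K^2 times the series of \<alpha>: 4
  from the covariance inequality, 2 for the two sides of the diagonal. The growth is therefore
  linear in the number of summands, whatever the index set.\<close>

lemma expectation_sum_power2_le:
  assumes "finite I"
  shows "expectation (\<lambda>\<omega>. (\<Sum>i\<in>I. X i \<omega>)\<^sup>2) \<le> real (card I) * (8 * K\<^sup>2 * suminf \<alpha>)"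
proof -
  have "expectation (\<lambda>\<omega>. (\<Sum>i\<in>I. X i \<omega>)\<^sup>2) = (\<Sum>i\<in>I. \<Sum>j\<in>I. expectation (\<lambda>\<omega>. X i \<omega> * X j \<omega>))"
    using expectation_sum_mult[OF assms assms] by (simp add: power2_eq_square)
  also have "\<dots> \<le> (\<Sum>i\<in>I. \<Sum>j\<in>I. 4 * K\<^sup>2 * \<alpha> (nat_dist i j))"
    using covariance_X_le abs_le_D1 by (intro sum_mono) blast
  also have "\<dots> = (\<Sum>i\<in>I. 4 * K\<^sup>2 * (\<Sum>j\<in>I. \<alpha> (nat_dist i j)))"
    by (simp add: sum_distrib_left)
  also have "\<dots> \<le> (\<Sum>i\<in>I. 4 * K\<^sup>2 * (2 * suminf \<alpha>))"
    using \<alpha>_nonneg summable_\<alpha> assms by (intro sum_mono mult_left_mono sum_nat_dist_le_suminf) auto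
  finally show ?thesis
    by simp
qed

section \<open>Window sums and products of a summand with its window\<close>

definition S :: "nat \<Rightarrow> 'a \<Rightarrow> real" where
  "S N \<omega> = (\<Sum>j<N. X j \<omega>)"

definition W :: "nat \<Rightarrow> nat \<Rightarrow> nat \<Rightarrow> 'a \<Rightarrow> real" where
  "W N m j \<omega> = (\<Sum>i | i < N \<and> nat_dist i j \<le> m. X i \<omega>)"

text \<open>Summed over j < N, these products form the part of the square of \<open>S N\<close>
  within distance m of the diagonal: their total mean approximates the variance of
  \<open>S N\<close>, and their deviation from it is an error term.\<close>

definition T :: "nat \<Rightarrow> nat \<Rightarrow> nat \<Rightarrow> 'a \<Rightarrow> real" where
  "T N m j \<omega> = X j \<omega> * W N m j \<omega>"

lemma S_meas[measurable]: "S N \<in> borel_measurable M"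
  unfolding S_def by measurable

lemma W_meas[measurable]: "W N m j \<in> borel_measurable M"
  unfolding W_def by measurable

lemma T_meas[measurable]: "T N m j \<in> borel_measurable M"
  unfolding T_def by measurable

lemma W_bound: "\<omega> \<in> space M \<Longrightarrow> \<bar>W N m j \<omega>\<bar> \<le> (2 * real m + 1) * K"
proof -
  assume "\<omega> \<in> space M"
  then have "\<bar>W N m j \<omega>\<bar> \<le> real (card {i. i < N \<and> nat_dist i j \<le> m}) * K"
    unfolding W_def by (rule sum_X_bound)
  also have "\<dots> \<le> real (2 * m + 1) * K"
    using card_nat_dist_le K_nonneg by (intro mult_right_mono) (auto simp del: of_nat_add of_nat_mult of_nat_Suc)
  finally show ?thesis
    by (simp add: algebra_simps)
qed

lemma T_bound: "\<omega> \<in> space M \<Longrightarrow> \<bar>T N m j \<omega>\<bar> \<le> K\<^sup>2 * (2 * real m + 1)"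
proof -
  assume "\<omega> \<in> space M"
  then have "\<bar>X j \<omega>\<bar> * \<bar>W N m j \<omega>\<bar> \<le> K * ((2 * real m + 1) * K)"
    using X_bound W_bound K_nonneg by (intro mult_mono) auto
  then show ?thesis
    by (simp add: T_def abs_mult power2_eq_square algebra_simps)
qed

lemma W_power2_le: "expectation (\<lambda>\<omega>. (W N m j \<omega>)\<^sup>2) \<le> (2 * real m + 1) * (8 * K\<^sup>2 * suminf \<alpha>)"
proof -
  have "expectation (\<lambda>\<omega>. (W N m j \<omega>)\<^sup>2) \<le> real (card {i. i < N \<and> nat_dist i j \<le> m}) * (8 * K\<^sup>2 * suminf \<alpha>)"
    unfolding W_def by (intro expectation_sum_power2_le) auto
  also have "\<dots> \<le> real (2 * m + 1) * (8 * K\<^sup>2 * suminf \<alpha>)"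
    using card_nat_dist_le suminf_\<alpha>_nonneg
    by (intro mult_right_mono) (auto simp del: of_nat_add of_nat_mult of_nat_Suc)
  finally show ?thesis
    by (simp add: algebra_simps)
qed

lemma integrable_W_power2: "integrable M (\<lambda>\<omega>. (W N m j \<omega>)\<^sup>2)"
proof (rule integrable_bounded[where B="((2 * real m + 1) * K)\<^sup>2"])
  fix \<omega> assume "\<omega> \<in> space M"
  from power_mono[OF W_bound[OF this, of N m j], of 2] show "norm ((W N m j \<omega>)\<^sup>2) \<le> ((2 * real m + 1) * K)\<^sup>2"
    by simp
qed simp

text \<open>Only the factor X_j is bounded pointwise. The window keeps its second moment of order m,
  which gains a factor m over squaring \<open>T_bound\<close>.\<close>

lemma T_power2_le: "expectation (\<lambda>\<omega>. (T N m j \<omega>)\<^sup>2) \<le> K\<^sup>2 * ((2 * real m + 1) * (8 * K\<^sup>2 * suminf \<alpha>))"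
proof -
  have "expectation (\<lambda>\<omega>. (T N m j \<omega>)\<^sup>2) \<le> expectation (\<lambda>\<omega>. K\<^sup>2 * (W N m j \<omega>)\<^sup>2)"
  proof (rule integral_mono)
    show "integrable M (\<lambda>\<omega>. (T N m j \<omega>)\<^sup>2)"
    proof (rule integrable_bounded[where B="(K\<^sup>2 * (2 * real m + 1))\<^sup>2"])
      fix \<omega> assume "\<omega> \<in> space M"
      from power_mono[OF T_bound[OF this, of N m j], of 2] show "norm ((T N m j \<omega>)\<^sup>2) \<le> (K\<^sup>2 * (2 * real m + 1))\<^sup>2"
        by simp
    qed simp
    show "integrable M (\<lambda>\<omega>. K\<^sup>2 * (W N m j \<omega>)\<^sup>2)"
      using integrable_W_power2 by simp
    fix \<omega> assume "\<omega> \<in> space M"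
    from power_mono[OF X_bound[OF this, of j], of 2]
    show "(T N m j \<omega>)\<^sup>2 \<le> K\<^sup>2 * (W N m j \<omega>)\<^sup>2"
      by (simp add: T_def power_mult_distrib mult_right_mono)
  qed
  also have "\<dots> \<le> K\<^sup>2 * ((2 * real m + 1) * (8 * K\<^sup>2 * suminf \<alpha>))"
    using W_power2_le by (simp add: mult_left_mono)
  finally show ?thesis .
qed

lemma T_meas_F:
  assumes "{j - m..j + m} \<subseteq> I"
  shows "T N m j \<in> borel_measurable (F I)"
proof -
  have [measurable]: "X i \<in> borel_measurable (F I)" if "nat_dist i j \<le> m" for i
    using that by (intro X_meas_F subsetD[OF assms]) (auto simp: nat_dist_def)
  have "X j \<in> borel_measurable (F I)"
    by (simp add: nat_dist_def)
  moreover have "W N m j \<in> borel_measurable (F I)"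
    unfolding W_def by measurable
  ultimately show ?thesis
    unfolding T_def[abs_def] by measurable
qed

definition CovT :: "nat \<Rightarrow> nat \<Rightarrow> nat \<Rightarrow> nat \<Rightarrow> real" where
  "CovT N m i j = expectation (\<lambda>\<omega>. (T N m i \<omega> - expectation (T N m i)) * (T N m j \<omega> - expectation (T N m j)))"

lemma integrable_T: "integrable M (T N m j)"
  using T_bound by (intro integrable_bounded) auto

lemma integrable_TT: "integrable M (\<lambda>\<omega>. T N m i \<omega> * T N m j \<omega>)"
  using T_bound by (intro integrable_bounded[where B="(K\<^sup>2 * (2 * real m + 1)) * (K\<^sup>2 * (2 * real m + 1))"])
    (auto simp: abs_mult intro!: mult_mono)

lemma CovT_eq:
  "CovT N m i j = expectation (\<lambda>\<omega>. T N m i \<omega> * T N m j \<omega>) - expectation (T N m i) * expectation (T N m j)"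
  by (simp add: CovT_def algebra_simps integrable_T integrable_TT prob_space)

lemma CovT_commute: "CovT N m i j = CovT N m j i"
  by (simp add: CovT_def mult.commute)

text \<open>The windows around i and j are separated by a gap of |i - j| - 2m, and each product is
  bounded by K^2 (2m + 1).\<close>

lemma CovT_far:
  assumes "2 * m \<le> nat_dist i j"
  shows "\<bar>CovT N m i j\<bar> \<le> 4 * K^4 * (2 * real m + 1)\<^sup>2 * \<alpha> (nat_dist i j - 2 * m)"
proof -
  have *: "\<bar>CovT N m i j\<bar> \<le> 4 * K^4 * (2 * real m + 1)\<^sup>2 * \<alpha> (j - i - 2 * m)" if "i + 2 * m \<le> j" for i j
  proof -
    have eq: "i + m + (j - i - 2 * m) = j - m"
      using that by simp
    have "\<bar>CovT N m i j\<bar> \<le> 4 * (K\<^sup>2 * (2 * real m + 1)) * (K\<^sup>2 * (2 * real m + 1)) * \<alpha> (j - i - 2 * m)"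
      unfolding CovT_eq using mixing[of "i + m" "j - i - 2 * m"] unfolding eq
      by (rule covariance_le) (auto intro!: T_meas_F T_bound)
    then show ?thesis
      by (simp add: power2_eq_square power4_eq_xxxx algebra_simps)
  qed
  show ?thesis
    using *[of i j] *[of j i] assms CovT_commute[of N m i j] by (cases "i \<le> j") (auto simp: nat_dist_def)
qed

lemma CovT_near: "\<bar>CovT N m i j\<bar> \<le> K\<^sup>2 * ((2 * real m + 1) * (8 * K\<^sup>2 * suminf \<alpha>))"
proof -
  have c: "expectation (\<lambda>\<omega>. (T N m i \<omega> - expectation (T N m i))\<^sup>2) \<le> K\<^sup>2 * ((2 * real m + 1) * (8 * K\<^sup>2 * suminf \<alpha>))" for i
    by (rule order_trans[OF expectation_power2_centred_le T_power2_le])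
      (auto simp: integrable_T power2_eq_square integrable_TT)
  show ?thesis
    unfolding CovT_def
    by (intro abs_expectation_mult_le c)
      (auto simp: integrable_T power2_eq_square integrable_TT algebra_simps)
qed

text \<open>Each i has O(m) neighbours within distance 2m, whose covariances are O(m) by
  \<open>CovT_near\<close>; the farther indices contribute O(m^2) through the series of \<alpha>.
  With 4m + 1 \<le> 2(2m + 1) the near part yields 16 K^4 and the far part 8 K^4, together 24
  K^4.\<close>

lemma variance_sum_T_le:
  "expectation (\<lambda>\<omega>. (\<Sum>j<N. T N m j \<omega> - expectation (T N m j))\<^sup>2)
    \<le> real N * ((2 * real m + 1)\<^sup>2 * (24 * K^4 * suminf \<alpha>))"
proof -
  define c1 c2 where "c1 = K\<^sup>2 * ((2 * real m + 1) * (8 * K\<^sup>2 * suminf \<alpha>))" and "c2 = 4 * K^4 * (2 * real m + 1)\<^sup>2"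
  have c: "0 \<le> c1" "0 \<le> c2"
    using suminf_\<alpha>_nonneg by (auto simp: c1_def c2_def)
  \<comment> \<open>\<alpha> delayed by 2m and padded with zeros: a function of the distance alone,
    with the same sum as \<alpha>.\<close>
  define h where "h d = (if 2 * m \<le> d then \<alpha> (d - 2 * m) else 0)" for d
  have "(\<lambda>d. h (d + 2 * m)) sums suminf \<alpha>"
    using summable_\<alpha> by (simp add: h_def summable_sums)
  then have "h sums suminf \<alpha>"
    by (subst (asm) sums_iff_shift) (simp add: h_def)
  then have h: "summable h" "suminf h = suminf \<alpha>" "\<And>d. 0 \<le> h d"
    using \<alpha>_nonneg by (auto simp: sums_iff h_def)
  have "expectation (\<lambda>\<omega>. (\<Sum>j<N. T N m j \<omega> - expectation (T N m j))\<^sup>2) = (\<Sum>i<N. \<Sum>j<N. CovT N m i j)"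
    unfolding power2_eq_square sum_product CovT_def
    by (subst Bochner_Integration.integral_sum)
      (auto simp: integrable_T integrable_TT algebra_simps intro!: sum.cong Bochner_Integration.integral_sum)
  also have "\<dots> \<le> (\<Sum>i<N. \<Sum>j<N. (if nat_dist j i \<le> 2 * m then c1 else 0) + c2 * h (nat_dist i j))"
  proof (intro sum_mono)
    fix i j
    show "CovT N m i j \<le> (if nat_dist j i \<le> 2 * m then c1 else 0) + c2 * h (nat_dist i j)"
    proof (cases "nat_dist i j \<le> 2 * m")
      case True
      then show ?thesis
        using CovT_near[of N m i j] mult_nonneg_nonneg[OF c(2) h(3)[of "nat_dist i j"]]
        by (simp add: nat_dist_commute[of j i] c1_def)
    next
      case False
      then show ?thesis
        using CovT_far[of m i j N] by (simp add: nat_dist_commute[of j i] c2_def h_def)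
    qed
  qed
  also have "\<dots> = (\<Sum>i<N. real (card {j. j < N \<and> nat_dist j i \<le> 2 * m}) * c1 + c2 * (\<Sum>j<N. h (nat_dist i j)))"
    by (simp add: sum.distrib sum_distrib_left sum.If_cases lessThan_def Int_def)
  also have "\<dots> \<le> (\<Sum>i<N. real (2 * (2 * m) + 1) * c1 + c2 * (2 * suminf \<alpha>))"
    unfolding h(2)[symmetric]
    by (intro sum_mono add_mono mult_right_mono mult_left_mono sum_nat_dist_le_suminf c h
        of_nat_mono card_nat_dist_le) auto
  also have "\<dots> = real N * ((4 * real m + 1) * c1 + c2 * (2 * suminf \<alpha>))"
    by (simp add: algebra_simps)
  also have "\<dots> \<le> real N * ((2 * (2 * real m + 1)) * c1 + c2 * (2 * suminf \<alpha>))"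
    using c by (intro mult_left_mono add_mono mult_right_mono) auto
  also have "\<dots> = real N * ((2 * real m + 1)\<^sup>2 * (24 * K^4 * suminf \<alpha>))"
    by (simp add: c1_def c2_def power2_eq_square power4_eq_xxxx algebra_simps)
  finally show ?thesis .
qed

text \<open>The difference consists of the covariances at distance greater than m, so every row is
  controlled by a tail of the series of \<alpha>.\<close>

lemma sum_expectation_T_approx:
  "\<bar>(\<Sum>j<N. expectation (T N m j)) - expectation (\<lambda>\<omega>. (S N \<omega>)\<^sup>2)\<bar>
    \<le> real N * (8 * K\<^sup>2 * (\<Sum>d. \<alpha> (d + Suc m)))"
proof -
  define h where "h d = (if Suc m \<le> d then \<alpha> d else 0)" for d
  have "(\<lambda>d. h (d + Suc m)) sums (\<Sum>d. \<alpha> (d + Suc m))"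
    using summable_ignore_initial_segment[OF summable_\<alpha>, of "Suc m"] by (simp add: h_def summable_sums del: add_Suc_right)
  then have "h sums (\<Sum>d. \<alpha> (d + Suc m))"
    by (subst (asm) sums_iff_shift) (simp add: h_def)
  then have h: "summable h" "suminf h = (\<Sum>d. \<alpha> (d + Suc m))" "\<And>d. 0 \<le> h d"
    using \<alpha>_nonneg by (auto simp: sums_iff h_def)
  let ?c = "\<lambda>i j. expectation (\<lambda>\<omega>. X i \<omega> * X j \<omega>)"
  have ET: "expectation (T N m j) = (\<Sum>i<N. if nat_dist i j \<le> m then ?c j i else 0)" for j
  proof -
    have "expectation (T N m j) = (\<Sum>i | i < N \<and> nat_dist i j \<le> m. ?c j i)"
      using expectation_sum_mult[of "{j}" "{i. i < N \<and> nat_dist i j \<le> m}"]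
      by (simp add: T_def[abs_def] W_def)
    also have "\<dots> = (\<Sum>i<N. if nat_dist i j \<le> m then ?c j i else 0)"
      by (intro sum.mono_neutral_cong_left) auto
    finally show ?thesis .
  qed
  have "(\<Sum>j<N. expectation (T N m j)) - expectation (\<lambda>\<omega>. (S N \<omega>)\<^sup>2)
      = (\<Sum>j<N. \<Sum>i<N. (if nat_dist i j \<le> m then ?c j i else 0) - ?c j i)"
    using expectation_sum_mult[of "{..<N}" "{..<N}"]
    by (simp add: ET S_def power2_eq_square sum_subtractf)
  also have "\<bar>\<dots>\<bar> \<le> (\<Sum>j<N. \<Sum>i<N. 4 * K\<^sup>2 * h (nat_dist j i))"
  proof (intro order_trans[OF sum_abs] sum_mono)
    fix i j
    show "\<bar>(if nat_dist i j \<le> m then ?c j i else 0) - ?c j i\<bar> \<le> 4 * K\<^sup>2 * h (nat_dist j i)"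
      using covariance_X_le[of j i] by (auto simp: h_def nat_dist_commute[of j i])
  qed
  also have "\<dots> = (\<Sum>j<N. 4 * K\<^sup>2 * (\<Sum>i<N. h (nat_dist j i)))"
    by (simp add: sum_distrib_left)
  also have "\<dots> \<le> (\<Sum>j<N. 4 * K\<^sup>2 * (2 * suminf h))"
    by (intro sum_mono mult_left_mono sum_nat_dist_le_suminf h) auto
  also have "\<dots> = real N * (8 * K\<^sup>2 * (\<Sum>d. \<alpha> (d + Suc m)))"
    unfolding h(2) by simp
  finally show ?thesis .
qed

end

section \<open>The central limit theorem for bounded mixing sequences\<close>

lemma norm_iexp_minus_linear_le:
  fixes x :: real
  shows "norm (iexp x - 1 - \<i> * x) \<le> x\<^sup>2 / 2"
  using iexp_approx1[of x 1] by (simp add: numeral_2_eq_2 algebra_simps)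

lemma norm_integral_le:
  fixes f :: "'a \<Rightarrow> 'b :: {banach, second_countable_topology}"
  assumes "integrable M f" "integrable M g" "\<And>x. x \<in> space M \<Longrightarrow> norm (f x) \<le> g x"
  shows "norm (integral\<^sup>L M f) \<le> integral\<^sup>L M g"
  using assms by (intro order_trans[OF integral_norm_bound integral_mono]) auto

section \<open>The differential equation for the characteristic function\<close>

context bounded_mixing_sequence
begin

definition \<phi> :: "nat \<Rightarrow> real \<Rightarrow> complex" where
  "\<phi> N t = (CLINT \<omega>|M. iexp (t * (S N \<omega> / sqrt N)))"

definition \<phi>' :: "nat \<Rightarrow> real \<Rightarrow> complex" where
  "\<phi>' N t = (CLINT \<omega>|M. \<i> * (S N \<omega> / sqrt N) * iexp (t * (S N \<omega> / sqrt N)))"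

lemma S_bound: "\<omega> \<in> space M \<Longrightarrow> \<bar>S N \<omega>\<bar> \<le> real N * K"
  unfolding S_def using sum_X_bound[of \<omega> "{..<N}"] by simp

text \<open>For fixed N the normalised sum is bounded, so the Taylor remainder is uniformly
  quadratic in s - t. The bound \<open>B\<close> grows with N, which is harmless as no limit in N is
  taken here.\<close>

lemma \<phi>_has_vector_derivative: "(\<phi> N has_vector_derivative \<phi>' N t) (at t within A)"
proof -
  define Y where "Y \<omega> = S N \<omega> / sqrt N" for \<omega>
  have [measurable]: "Y \<in> borel_measurable M"
    unfolding Y_def by measurable
  define B where "B = real N * K / sqrt N"
  have Y: "\<bar>Y \<omega>\<bar> \<le> B" if "\<omega> \<in> space M" for \<omega>
    using S_bound[OF that, of N] by (auto simp: Y_def B_def intro!: divide_right_mono)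
  have i: "integrable M (\<lambda>\<omega>. iexp (s * Y \<omega>))" "integrable M (\<lambda>\<omega>. \<i> * Y \<omega> * iexp (s * Y \<omega>))" for s
    by (rule integrable_bounded[where B=1], auto)
       (rule integrable_bounded[where B=B], auto simp: norm_mult Y)
  have le: "norm (\<phi> N s - \<phi> N t - (s - t) *\<^sub>R \<phi>' N t) \<le> B\<^sup>2 / 2 * \<bar>s - t\<bar> * \<bar>s - t\<bar>" for s
  proof -
    have "\<phi> N s - \<phi> N t - (s - t) *\<^sub>R \<phi>' N t
        = (CLINT \<omega>|M. iexp (s * Y \<omega>) - iexp (t * Y \<omega>) - (s - t) *\<^sub>R (\<i> * Y \<omega> * iexp (t * Y \<omega>)))"
      unfolding \<phi>_def \<phi>'_def Y_def[symmetric] using i by simp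
    also have "norm \<dots> \<le> (\<integral>\<omega>. B\<^sup>2 / 2 * \<bar>s - t\<bar> * \<bar>s - t\<bar> \<partial>M)"
    proof (rule norm_integral_le)
      fix \<omega> assume \<omega>: "\<omega> \<in> space M"
      have "iexp (s * Y \<omega>) - iexp (t * Y \<omega>) - (s - t) *\<^sub>R (\<i> * Y \<omega> * iexp (t * Y \<omega>))
          = iexp (t * Y \<omega>) * (iexp ((s - t) * Y \<omega>) - 1 - \<i> * ((s - t) * Y \<omega>))"
        by (simp add: algebra_simps scaleR_conv_of_real flip: exp_add)
      also have "norm \<dots> \<le> ((s - t) * Y \<omega>)\<^sup>2 / 2"
        using norm_iexp_minus_linear_le[of "(s - t) * Y \<omega>"] by (simp add: norm_mult)
      also have "\<dots> \<le> ((s - t)\<^sup>2 * B\<^sup>2) / 2"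
        using power_mono[OF Y[OF \<omega>], of 2] by (simp add: power_mult_distrib mult_left_mono)
      finally show "norm (iexp (s * Y \<omega>) - iexp (t * Y \<omega>) - (s - t) *\<^sub>R (\<i> * Y \<omega> * iexp (t * Y \<omega>)))
          \<le> B\<^sup>2 / 2 * \<bar>s - t\<bar> * \<bar>s - t\<bar>"
        by (simp add: power2_eq_square algebra_simps)
    qed (use i in auto)
    finally show ?thesis
      by (simp add: prob_space)
  qed
  have "((\<lambda>s. norm (\<phi> N s - \<phi> N t - (s - t) *\<^sub>R \<phi>' N t) / \<bar>s - t\<bar>) \<longlongrightarrow> 0) (at t within A)"
  proof (rule Lim_null_comparison)
    show "\<forall>\<^sub>F s in at t within A. norm (norm (\<phi> N s - \<phi> N t - (s - t) *\<^sub>R \<phi>' N t) / \<bar>s - t\<bar>) \<le> B\<^sup>2 / 2 * \<bar>s - t\<bar>"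
      using le by (auto simp: eventually_at_filter divide_simps intro!: always_eventually)
    have "((\<lambda>s. B\<^sup>2 / 2 * \<bar>s - t\<bar>) \<longlongrightarrow> B\<^sup>2 / 2 * \<bar>t - t\<bar>) (at t within A)"
      by (intro tendsto_intros)
    then show "((\<lambda>s. B\<^sup>2 / 2 * \<bar>s - t\<bar>) \<longlongrightarrow> 0) (at t within A)"
      by simp
  qed
  then show ?thesis
    unfolding has_vector_derivative_def has_derivative_iff_norm
    by (simp add: bounded_linear_scaleR_left)
qed

lemma expectation_X_outside_window_le:
  fixes \<theta> :: real
  shows "norm (CLINT \<omega>|M. X j \<omega> * iexp (\<theta> * (S N \<omega> - W N m j \<omega>))) \<le> 32 * K * \<alpha> (Suc m)"
proof -
  \<comment> \<open>Split off the future \<open>R\<close> first, then the past \<open>P\<close>; each costs one covariance inequality.\<close>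
  define P R where "P \<omega> = iexp (\<theta> * (\<Sum>i | i < N \<and> i + m < j. X i \<omega>))"
    and "R \<omega> = iexp (\<theta> * (\<Sum>i | i < N \<and> j + m < i. X i \<omega>))" for \<omega>
  have split: "{..<N} = {i. i < N \<and> i + m < j} \<union> {i. i < N \<and> nat_dist i j \<le> m} \<union> {i. i < N \<and> j + m < i}"
    by (auto simp: nat_dist_def)
  have "S N \<omega> = (\<Sum>i | i < N \<and> i + m < j. X i \<omega>) + W N m j \<omega> + (\<Sum>i | i < N \<and> j + m < i. X i \<omega>)" for \<omega>
    unfolding S_def W_def split
    by (subst sum.union_disjoint, force, force, force simp: nat_dist_def)+ simp
  then have eq: "X j \<omega> * iexp (\<theta> * (S N \<omega> - W N m j \<omega>)) = (P \<omega> * X j \<omega>) * R \<omega>" for \<omega>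
    by (simp add: P_def R_def algebra_simps flip: exp_add)
  have [measurable]: "X i \<in> borel_measurable (F {..j})" if "i \<le> j" for i
    using that by (intro X_meas_F) auto
  have [measurable]: "X i \<in> borel_measurable (F {j + Suc m..})" if "j + m < i" for i
    using that by (intro X_meas_F) auto
  have P: "P \<in> borel_measurable (F {..j})"
    unfolding P_def by measurable
  have R: "R \<in> borel_measurable (F {j + Suc m..})"
    unfolding R_def by measurable
  have Rn: "norm (CLINT \<omega>|M. R \<omega>) \<le> 1"
  proof -
    have [measurable]: "R \<in> borel_measurable M"
      unfolding R_def by measurable
    have "norm (CLINT \<omega>|M. R \<omega>) \<le> (\<integral>\<omega>. 1 \<partial>M)"
      by (rule norm_integral_le) (auto simp: R_def intro!: integrable_bounded[where B=1])
    then show ?thesis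
      by (simp add: prob_space)
  qed
  have "norm ((CLINT \<omega>|M. (P \<omega> * X j \<omega>) * R \<omega>) - (CLINT \<omega>|M. P \<omega> * X j \<omega>) * (CLINT \<omega>|M. R \<omega>))
      \<le> 16 * K * 1 * \<alpha> (Suc m)"
  proof (rule complex_covariance_le[OF mixing[of j "Suc m"] _ _ R])
    show "(\<lambda>\<omega>. P \<omega> * X j \<omega>) \<in> borel_measurable (F {..j})"
      using P by measurable
  qed (auto simp: norm_mult P_def R_def X_bound K_nonneg)
  moreover have "norm (CLINT \<omega>|M. P \<omega> * X j \<omega>) \<le> 16 * 1 * K * \<alpha> (Suc m)"
  proof (cases "m < j")
    \<comment> \<open>There is no past beyond the window, so the expectation is that of X_j alone.
      The truncated index \<open>j - Suc m\<close> would not lie \<open>Suc m\<close> steps before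
      \<open>j\<close> in this case.\<close>
    case False
    then have "P \<omega> = 1" for \<omega>
      by (simp add: P_def)
    then show ?thesis
      using K_nonneg \<alpha>_nonneg X_mean[of j] by simp
  next
    case True
    then have j: "j - Suc m + Suc m = j"
      by simp
    have [measurable]: "X i \<in> borel_measurable (F {..j - Suc m})" if "i + m < j" for i
      using that by (intro X_meas_F) auto
    have P': "P \<in> borel_measurable (F {..j - Suc m})"
      unfolding P_def by measurable
    have [measurable]: "X j \<in> borel_measurable (F {j..})"
      by (intro X_meas_F) auto
    have "norm ((CLINT \<omega>|M. P \<omega> * X j \<omega>) - (CLINT \<omega>|M. P \<omega>) * (CLINT \<omega>|M. X j \<omega>)) \<le> 16 * 1 * K * \<alpha> (Suc m)"
      using mixing[of "j - Suc m" "Suc m"] P' unfolding j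
      by (intro complex_covariance_le) (auto simp: P_def X_bound K_nonneg)
    then show ?thesis
      by (simp add: X_mean)
  qed
  moreover have "norm ((CLINT \<omega>|M. P \<omega> * X j \<omega>) * (CLINT \<omega>|M. R \<omega>)) \<le> norm (CLINT \<omega>|M. P \<omega> * X j \<omega>)"
    using Rn by (simp add: norm_mult mult_left_le)
  ultimately show ?thesis
    unfolding eq using norm_triangle_sub[of "CLINT \<omega>|M. (P \<omega> * X j \<omega>) * R \<omega>" "(CLINT \<omega>|M. P \<omega> * X j \<omega>) * (CLINT \<omega>|M. R \<omega>)"]
    by simp
qed

text \<open>Restoring the window multiplies by exp(-i \<theta> W), expanded here to first order.
  Using E[W^2] = O(m) and \<theta>^2 = t^2 / N, the N remainders divided by sqrt N add up to O(m /
  sqrt N).\<close>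

lemma second_order_remainder_le:
  fixes \<theta> :: real
  shows "norm (CLINT \<omega>|M. X j \<omega> * iexp (\<theta> * S N \<omega>) * (1 - iexp (- \<theta> * W N m j \<omega>) - \<i> * (\<theta> * W N m j \<omega>)))
    \<le> K * \<theta>\<^sup>2 / 2 * ((2 * real m + 1) * (8 * K\<^sup>2 * suminf \<alpha>))"
proof -
  have "norm (CLINT \<omega>|M. X j \<omega> * iexp (\<theta> * S N \<omega>) * (1 - iexp (- \<theta> * W N m j \<omega>) - \<i> * (\<theta> * W N m j \<omega>)))
      \<le> (\<integral>\<omega>. K * \<theta>\<^sup>2 / 2 * (W N m j \<omega>)\<^sup>2 \<partial>M)"
  proof (rule norm_integral_le)
    fix \<omega> assume \<omega>: "\<omega> \<in> space M"
    have "norm (1 - iexp (- \<theta> * W N m j \<omega>) - \<i> * (\<theta> * W N m j \<omega>)) \<le> (\<theta> * W N m j \<omega>)\<^sup>2 / 2"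
      using norm_iexp_minus_linear_le[of "- \<theta> * W N m j \<omega>"]
      by (subst norm_minus_cancel[symmetric]) (simp add: algebra_simps)
    then have "\<bar>X j \<omega>\<bar> * norm (1 - iexp (- \<theta> * W N m j \<omega>) - \<i> * (\<theta> * W N m j \<omega>)) \<le> K * ((\<theta> * W N m j \<omega>)\<^sup>2 / 2)"
      using X_bound[OF \<omega>] K_nonneg by (intro mult_mono) auto
    then show "norm (X j \<omega> * iexp (\<theta> * S N \<omega>) * (1 - iexp (- \<theta> * W N m j \<omega>) - \<i> * (\<theta> * W N m j \<omega>)))
        \<le> K * \<theta>\<^sup>2 / 2 * (W N m j \<omega>)\<^sup>2"
      by (simp add: norm_mult power_mult_distrib)
  next
    show "integrable M (\<lambda>\<omega>. K * \<theta>\<^sup>2 / 2 * (W N m j \<omega>)\<^sup>2)"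
      using integrable_W_power2 by simp
    show "integrable M (\<lambda>\<omega>. complex_of_real (X j \<omega>) * iexp (\<theta> * S N \<omega>) *
        (1 - iexp (- \<theta> * W N m j \<omega>) - \<i> * complex_of_real (\<theta> * W N m j \<omega>)))"
    proof (rule integrable_bounded[where B="K * (2 + \<bar>\<theta>\<bar> * ((2 * real m + 1) * K))"])
      fix \<omega> assume \<omega>: "\<omega> \<in> space M"
      have "norm (1 - iexp (- \<theta> * W N m j \<omega>) - \<i> * (\<theta> * W N m j \<omega>)) \<le> 1 + 1 + \<bar>\<theta>\<bar> * ((2 * real m + 1) * K)"
        using mult_left_mono[OF W_bound[OF \<omega>], of "\<bar>\<theta>\<bar>"]
        by (intro order_trans[OF norm_triangle_ineq4 add_mono] order_trans[OF norm_triangle_ineq4 add_mono])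
          (auto simp: norm_mult abs_mult)
      then show "norm (X j \<omega> * iexp (\<theta> * S N \<omega>) * (1 - iexp (- \<theta> * W N m j \<omega>) - \<i> * (\<theta> * W N m j \<omega>)))
          \<le> K * (2 + \<bar>\<theta>\<bar> * ((2 * real m + 1) * K))"
        unfolding norm_mult norm_of_real norm_exp_i_times mult_1_right
        using X_bound[OF \<omega>, of j] K_nonneg by (intro mult_mono) (auto simp: mult.commute)
    qed measurable
  qed
  also have "\<dots> \<le> K * \<theta>\<^sup>2 / 2 * ((2 * real m + 1) * (8 * K\<^sup>2 * suminf \<alpha>))"
    using W_power2_le K_nonneg unfolding integral_mult_right_zero by (intro mult_left_mono) auto
  finally show ?thesis .
qed

text \<open>In order: the summands decoupled from everything outside their window; the fluctuation
  of the sum of the \<open>T N m j\<close>; the distance of its mean per term from v; the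
  second-order remainder.\<close>

definition err :: "real \<Rightarrow> nat \<Rightarrow> nat \<Rightarrow> real \<Rightarrow> real" where
  "err v N m t = 32 * K * (sqrt N * \<alpha> (Suc m))
    + \<bar>t\<bar> * sqrt (24 * K^4 * suminf \<alpha>) * ((2 * real m + 1) / sqrt N)
    + \<bar>t\<bar> * (\<bar>expectation (\<lambda>\<omega>. (S N \<omega>)\<^sup>2) / N - v\<bar> + 8 * K\<^sup>2 * (\<Sum>d. \<alpha> (d + Suc m)))
    + t\<^sup>2 * (4 * K^3 * suminf \<alpha>) * ((2 * real m + 1) / sqrt N)"

text \<open>With e = exp(i \<theta> S), each X_j e splits into X_j exp(i \<theta> (S - W_j)), the
  first-order term i \<theta> T_j e and a remainder. The sum of the T_j is its mean q plus the
  fluctuation Z; the factor i / sqrt N turns i \<theta> q into -t q / N, which supplies the main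
  term because q / N is close to v.\<close>

lemma \<phi>'_approx:
  assumes N: "N > 0"
  shows "norm (\<phi>' N t + t * v * \<phi> N t) \<le> err v N m t"
proof -
  define \<theta> where "\<theta> = t / sqrt N"
  define e where "e \<omega> = iexp (\<theta> * S N \<omega>)" for \<omega>
  define q where "q = (\<Sum>j<N. expectation (T N m j))"
  define Z where "Z \<omega> = (\<Sum>j<N. T N m j \<omega> - expectation (T N m j))" for \<omega>
  let ?far = "\<lambda>j \<omega>. X j \<omega> * iexp (\<theta> * (S N \<omega> - W N m j \<omega>))"
  let ?near = "\<lambda>j \<omega>. X j \<omega> * iexp (\<theta> * S N \<omega>) * (1 - iexp (- \<theta> * W N m j \<omega>) - \<i> * (\<theta> * W N m j \<omega>))"
  have [measurable]: "e \<in> borel_measurable M" "Z \<in> borel_measurable M"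
    unfolding e_def Z_def by measurable
  have ne: "norm (e \<omega>) = 1" for \<omega>
    by (simp add: e_def)
  have iX: "integrable M (\<lambda>\<omega>. X j \<omega> * e \<omega>)" for j
    by (rule integrable_bounded[where B=K]) (auto simp: norm_mult ne X_bound)
  have iT: "integrable M (\<lambda>\<omega>. T N m j \<omega> * e \<omega>)" for j
    by (rule integrable_bounded[where B="K\<^sup>2 * (2 * real m + 1)"]) (auto simp: norm_mult ne T_bound)
  have ifar: "integrable M (?far j)" for j
    by (rule integrable_bounded[where B=K]) (auto simp: norm_mult X_bound)
  have ie: "integrable M e"
    by (rule integrable_bounded[where B=1]) (auto simp: ne)
  have eq: "X j \<omega> * e \<omega> - ?far j \<omega> - \<i> * \<theta> * (T N m j \<omega> * e \<omega>) = ?near j \<omega>" for j \<omega>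
    by (simp add: e_def T_def algebra_simps flip: exp_add)
  have inear: "integrable M (?near j)" for j
    unfolding eq[symmetric] using iX iT ifar by simp
  have Zi: "integrable M Z" "integrable M (\<lambda>\<omega>. (Z \<omega>)\<^sup>2)"
  proof -
    have b: "\<bar>Z \<omega>\<bar> \<le> (\<Sum>j<N. K\<^sup>2 * (2 * real m + 1) + \<bar>expectation (T N m j)\<bar>)" if "\<omega> \<in> space M" for \<omega>
      unfolding Z_def using T_bound[OF that]
      by (intro order_trans[OF sum_abs sum_mono] order_trans[OF abs_triangle_ineq4 add_mono]) auto
    show "integrable M Z"
      using b by (intro integrable_bounded) auto
    show "integrable M (\<lambda>\<omega>. (Z \<omega>)\<^sup>2)"
      using power_mono[OF b, of _ 2]
      by (intro integrable_bounded[where B="(\<Sum>j<N. K\<^sup>2 * (2 * real m + 1) + \<bar>expectation (T N m j)\<bar>)\<^sup>2"]) auto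
  qed
  have iZe: "integrable M (\<lambda>\<omega>. Z \<omega> * e \<omega>)"
    by (rule Bochner_Integration.integrable_bound[OF Zi(1)]) (auto simp: norm_mult ne)
  have \<phi>: "\<phi> N t = (CLINT \<omega>|M. e \<omega>)"
    by (simp add: \<phi>_def e_def \<theta>_def)
  have "\<phi>' N t = \<i> / sqrt N * (\<Sum>j<N. CLINT \<omega>|M. X j \<omega> * e \<omega>)"
  proof -
    have "\<phi>' N t = (CLINT \<omega>|M. \<i> / sqrt N * (\<Sum>j<N. X j \<omega> * e \<omega>))"
      unfolding \<phi>'_def
      by (intro Bochner_Integration.integral_cong refl)
        (simp add: S_def e_def \<theta>_def sum_distrib_right sum_distrib_left sum_divide_distrib algebra_simps)
    then show ?thesis
      using iX by simp
  qed
  also have "(\<Sum>j<N. CLINT \<omega>|M. X j \<omega> * e \<omega>)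
      = (\<Sum>j<N. (CLINT \<omega>|M. ?far j \<omega>) + \<i> * \<theta> * (CLINT \<omega>|M. T N m j \<omega> * e \<omega>) + (CLINT \<omega>|M. ?near j \<omega>))"
    unfolding eq[symmetric] using iX iT ifar by simp
  also have "\<dots> = (\<Sum>j<N. CLINT \<omega>|M. ?far j \<omega>) + \<i> * \<theta> * (CLINT \<omega>|M. (Z \<omega> + q) * e \<omega>) + (\<Sum>j<N. CLINT \<omega>|M. ?near j \<omega>)"
  proof -
    have "(CLINT \<omega>|M. (Z \<omega> + q) * e \<omega>) = (CLINT \<omega>|M. (\<Sum>j<N. T N m j \<omega> * e \<omega>))"
      by (intro Bochner_Integration.integral_cong refl) (simp add: Z_def q_def sum_subtractf sum_distrib_right)
    then show ?thesis
      using iT by (simp add: sum.distrib sum_distrib_left)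
  qed
  also have "(CLINT \<omega>|M. (Z \<omega> + q) * e \<omega>) = (CLINT \<omega>|M. Z \<omega> * e \<omega>) + q * \<phi> N t"
    unfolding \<phi> using iZe ie by (simp add: distrib_right)
  finally have \<phi>'_eq: "\<phi>' N t = \<i> / sqrt N * ((\<Sum>j<N. CLINT \<omega>|M. ?far j \<omega>)
      + \<i> * \<theta> * ((CLINT \<omega>|M. Z \<omega> * e \<omega>) + q * \<phi> N t) + (\<Sum>j<N. CLINT \<omega>|M. ?near j \<omega>))" .
  have "\<i> / complex_of_real (sqrt N) * (\<i> * complex_of_real \<theta>) = - (t / N)"
    using N by (simp add: \<theta>_def flip: of_real_mult)
  then have "\<i> / complex_of_real (sqrt N) * (f + \<i> * complex_of_real \<theta> * (z + q * \<phi> N t) + n) + t * v * \<phi> N t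
      = \<i> / sqrt N * f - t / N * z - t * (q / N - v) * \<phi> N t + \<i> / sqrt N * n" for f z n :: complex
    by (simp add: distrib_left flip: mult.assoc) (simp add: algebra_simps)
  then have main: "\<phi>' N t + t * v * \<phi> N t = \<i> / sqrt N * (\<Sum>j<N. CLINT \<omega>|M. ?far j \<omega>)
      - t / N * (CLINT \<omega>|M. Z \<omega> * e \<omega>) - t * (q / N - v) * \<phi> N t
      + \<i> / sqrt N * (\<Sum>j<N. CLINT \<omega>|M. ?near j \<omega>)"
    (is "_ = ?a - ?b - ?c + ?d")
    unfolding \<phi>'_eq .
  have n\<phi>: "norm (\<phi> N t) \<le> 1"
  proof -
    have "norm (CLINT \<omega>|M. e \<omega>) \<le> (\<integral>\<omega>. 1 \<partial>M)"
      using ie by (intro norm_integral_le) (auto simp: ne)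
    then show ?thesis
      by (simp add: prob_space \<phi>)
  qed
  have sq: "real N / sqrt N = sqrt N"
    using N by (simp add: real_div_sqrt)
  have a: "norm ?a \<le> 32 * K * (sqrt N * \<alpha> (Suc m))"
  proof -
    have "norm ?a = norm (\<Sum>j<N. CLINT \<omega>|M. ?far j \<omega>) / sqrt N"
      by (simp add: norm_mult norm_divide)
    also have "\<dots> \<le> (\<Sum>j<N. 32 * K * \<alpha> (Suc m)) / sqrt N"
      using expectation_X_outside_window_le by (intro divide_right_mono sum_norm_le) auto
    also have "\<dots> = 32 * K * (real N / sqrt N * \<alpha> (Suc m))"
      by simp
    finally show ?thesis
      unfolding sq .
  qed
  \<comment> \<open>The L1 norm of \<open>Z\<close> is bounded by its L2 norm, of order sqrt N times
    m; the prefactor t / N reduces this to m / sqrt N.\<close>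
  have b: "norm ?b \<le> \<bar>t\<bar> * sqrt (24 * K^4 * suminf \<alpha>) * ((2 * real m + 1) / sqrt N)"
  proof -
    have "norm (CLINT \<omega>|M. Z \<omega> * e \<omega>) \<le> expectation (\<lambda>\<omega>. \<bar>Z \<omega>\<bar>)"
      using iZe Zi by (intro norm_integral_le) (auto simp: norm_mult ne)
    also have "\<dots> \<le> sqrt (expectation (\<lambda>\<omega>. (Z \<omega>)\<^sup>2))"
      using Zi by (rule expectation_abs_le_sqrt)
    also have "\<dots> \<le> sqrt (real N * ((2 * real m + 1)\<^sup>2 * (24 * K^4 * suminf \<alpha>)))"
      using variance_sum_T_le unfolding Z_def by simp
    also have "\<dots> = sqrt N * ((2 * real m + 1) * sqrt (24 * K^4 * suminf \<alpha>))"
      by (simp add: real_sqrt_mult)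
    finally have "norm ?b \<le> \<bar>t\<bar> / N * (sqrt N * ((2 * real m + 1) * sqrt (24 * K^4 * suminf \<alpha>)))"
      unfolding norm_mult by (intro mult_mono) (auto simp: norm_divide)
    also have "\<dots> = \<bar>t\<bar> * sqrt (24 * K^4 * suminf \<alpha>) * ((2 * real m + 1) / (real N / sqrt N))"
      by simp
    finally show ?thesis
      unfolding sq .
  qed
  have c: "norm ?c \<le> \<bar>t\<bar> * (\<bar>expectation (\<lambda>\<omega>. (S N \<omega>)\<^sup>2) / N - v\<bar> + 8 * K\<^sup>2 * (\<Sum>d. \<alpha> (d + Suc m)))"
  proof -
    have "\<bar>q - expectation (\<lambda>\<omega>. (S N \<omega>)\<^sup>2)\<bar> / N \<le> 8 * K\<^sup>2 * (\<Sum>d. \<alpha> (d + Suc m))"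
      using sum_expectation_T_approx[of N m] N by (simp add: q_def pos_divide_le_eq mult.commute)
    then have "\<bar>q / N - expectation (\<lambda>\<omega>. (S N \<omega>)\<^sup>2) / N\<bar> \<le> 8 * K\<^sup>2 * (\<Sum>d. \<alpha> (d + Suc m))"
      by (simp flip: diff_divide_distrib)
    then have "\<bar>q / N - v\<bar> \<le> \<bar>expectation (\<lambda>\<omega>. (S N \<omega>)\<^sup>2) / N - v\<bar> + 8 * K\<^sup>2 * (\<Sum>d. \<alpha> (d + Suc m))"
      by linarith
    moreover have "norm ?c \<le> \<bar>t\<bar> * \<bar>q / N - v\<bar>"
    proof -
      have "norm ?c = \<bar>t\<bar> * \<bar>q / N - v\<bar> * norm (\<phi> N t)"
        by (simp add: norm_mult abs_mult flip: of_real_diff of_real_divide of_real_mult)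
      then show ?thesis
        using n\<phi> by (simp add: mult_left_le)
    qed
    ultimately show ?thesis
      by (meson abs_ge_zero mult_left_mono order_trans)
  qed
  have d: "norm ?d \<le> t\<^sup>2 * (4 * K^3 * suminf \<alpha>) * ((2 * real m + 1) / sqrt N)"
  proof -
    have "norm ?d = norm (\<Sum>j<N. CLINT \<omega>|M. ?near j \<omega>) / sqrt N"
      by (simp add: norm_mult norm_divide)
    also have "\<dots> \<le> (\<Sum>j<N. K * \<theta>\<^sup>2 / 2 * ((2 * real m + 1) * (8 * K\<^sup>2 * suminf \<alpha>))) / sqrt N"
      by (intro divide_right_mono sum_norm_le second_order_remainder_le) auto
    also have "\<dots> = (real N * \<theta>\<^sup>2) * (4 * K^3 * suminf \<alpha>) * ((2 * real m + 1) / sqrt N)"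
      by (simp add: power2_eq_square power3_eq_cube)
    also have "real N * \<theta>\<^sup>2 = t\<^sup>2"
      using N by (simp add: \<theta>_def power_divide)
    finally show ?thesis .
  qed
  have "norm (\<phi>' N t + t * v * \<phi> N t) \<le> norm ?a + norm ?b + norm ?c + norm ?d"
    unfolding main
    by (intro order_trans[OF norm_triangle_ineq add_mono] order_trans[OF norm_triangle_ineq4 add_mono]) auto
  then show ?thesis
    using a b c d by (simp add: err_def)
qed

end

section \<open>The Gaussian limit and the decay of monotone summable sequences\<close>

lemma char_centred_gaussian:
  assumes "0 \<le> v"
  shows "char (centred_gaussian v) t = exp (- (v * t\<^sup>2) / 2)"
proof (cases "v = 0")
  case True
  then show ?thesis
    by (simp add: centred_gaussian_def char_def integral_return)
next
  case False
  then have v: "0 < sqrt v"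
    using assms by simp
  have "distributed std_normal_distribution lborel (\<lambda>x. x) (normal_density 0 1)"
    by (auto simp: distributed_def distr_id2 intro!: measurable_ident_sets)
  then have "distributed std_normal_distribution lborel (\<lambda>x. 0 + sqrt v * x) (normal_density (0 + sqrt v * 0) (\<bar>sqrt v\<bar> * 1))"
    using v by (intro prob_space.normal_density_affine prob_space_normal_density) auto
  then have "distr std_normal_distribution lborel (\<lambda>x. sqrt v * x) = centred_gaussian v"
    using v False by (simp add: distributed_def centred_gaussian_def)
  then have "char (centred_gaussian v) t = char (distr std_normal_distribution lborel (\<lambda>x. sqrt v * x)) t"
    by simp
  also have "\<dots> = char std_normal_distribution (t * sqrt v)"
    unfolding char_def by (subst integral_distr) (auto simp: mult.assoc)
  finally show ?thesis
    using assms by (simp add: char_std_normal_distribution power_mult_distrib mult.commute)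
qed

lemma real_distribution_centred_gaussian:
  assumes "0 \<le> v"
  shows "real_distribution (centred_gaussian v)"
  using assms prob_space_normal_density[of "sqrt v" 0]
  by (auto simp: centred_gaussian_def real_distribution_def real_distribution_axioms_def prob_space_return)

text \<open>The Abel-Pringsheim theorem: by monotonicity, n - N copies of \<open>f n\<close> are
  dominated by the block of the series from N to n, and n - N is at least n / 2. It turns summable
  mixing into a rate.\<close>

lemma decseq_summable_times_tendsto_0:
  fixes f :: "nat \<Rightarrow> real"
  assumes "decseq f" "summable f" "\<And>n. 0 \<le> f n"
  shows "(\<lambda>n. real n * f n) \<longlonglongrightarrow> 0"
proof (rule tendstoI)
  fix e :: real assume "0 < e"
  then obtain N where N: "norm (\<Sum>k=m..<n. f k) < e / 2" if "N \<le> m" for m n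
    using assms(2) unfolding summable_Cauchy by (metis half_gt_zero)
  have "dist (real n * f n) 0 < e" if n: "n > 2 * N" for n
  proof -
    have "real n / 2 * f n \<le> real (n - N) * f n"
      using n assms(3) by (intro mult_right_mono) auto
    also have "\<dots> = (\<Sum>k=N..<n. f n)"
      by simp
    also have "\<dots> \<le> (\<Sum>k=N..<n. f k)"
      using assms(1) by (intro sum_mono) (auto simp: decseq_def)
    also have "\<dots> < e / 2"
      using N[of N n] by simp
    finally show ?thesis
      using assms(3)[of n] by (simp add: dist_norm)
  qed
  then show "\<forall>\<^sub>F n in sequentially. dist (real n * f n) 0 < e"
    unfolding eventually_sequentially by (intro exI[of _ "Suc (2 * N)"]) auto
qed

section \<open>Choice of the window and integration of the differential equation\<close>

context bounded_mixing_sequence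
begin

text \<open>Makes the error at the endpoint t a uniform bound on the segment from 0 to t, with the
  same N and m throughout.\<close>

lemma err_mono: "\<bar>s\<bar> \<le> \<bar>t\<bar> \<Longrightarrow> err v N m s \<le> err v N m t"
  unfolding err_def using suminf_\<alpha>_nonneg K_nonneg \<alpha>_nonneg summable_ignore_initial_segment[OF summable_\<alpha>, of "Suc m"]
  by (intro add_mono mult_right_mono) (auto simp: abs_le_square_iff intro!: suminf_nonneg add_nonneg_nonneg mult_nonneg_nonneg)

lemma err_small:
  assumes V: "(\<lambda>N. expectation (\<lambda>\<omega>. (S N \<omega>)\<^sup>2) / N) \<longlonglongrightarrow> v" and e: "0 < e"
  shows "\<forall>\<^sub>F N in sequentially. \<exists>m. err v N m t < e"
proof -
  define c where "c = \<bar>t\<bar> * sqrt (24 * K^4 * suminf \<alpha>) + t\<^sup>2 * (4 * K^3 * suminf \<alpha>)"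
  have c: "0 \<le> c"
    using suminf_\<alpha>_nonneg K_nonneg by (auto simp: c_def)
  \<comment> \<open>\<open>c\<close> collects the coefficients of (2m + 1) / sqrt N in
    \<open>err\<close>, so the window terms tend to at most 2 c \<delta>. The summand 1 covers the
    case c = 0.\<close>
  define \<delta> where "\<delta> = e / (4 * (c + 1))"
  have \<delta>: "0 < \<delta>" "2 * c * \<delta> < e"
    using e c by (auto simp: \<delta>_def field_simps intro!: add_pos_nonneg)
  define m where "m N = nat \<lfloor>\<delta> * sqrt (real N)\<rfloor>" for N :: nat
  have m1: "real (m N) \<le> \<delta> * sqrt N" and m2: "\<delta> * sqrt N \<le> real (Suc (m N))" for N
    using \<delta>(1) by (auto simp: m_def) linarith
  have "filterlim (\<lambda>N. \<delta> * sqrt (real N)) at_top sequentially"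
    using \<delta>(1) by real_asymp
  then have "filterlim m at_top sequentially"
    unfolding m_def by (intro filterlim_compose[OF filterlim_nat_sequentially] filterlim_compose[OF filterlim_floor_sequentially])
  then have mlim: "filterlim (\<lambda>N. Suc (m N)) at_top sequentially"
    by (rule filterlim_compose[OF filterlim_Suc])
  have tail: "(\<lambda>N. \<Sum>d. \<alpha> (d + Suc (m N))) \<longlonglongrightarrow> 0"
    by (rule filterlim_compose[OF _ mlim]) (rule suminf_exist_split2[OF summable_\<alpha>])
  \<comment> \<open>Rounding down still leaves \<delta> sqrt N \<le> m + 1, so sqrt N is traded for
    (m + 1) / \<delta> and the product (m + 1) \<alpha>(m + 1) tends to 0.\<close>
  have \<alpha>0: "(\<lambda>N. sqrt N * \<alpha> (Suc (m N))) \<longlonglongrightarrow> 0"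
  proof (rule Lim_null_comparison)
    show "\<forall>\<^sub>F N in sequentially. norm (sqrt (real N) * \<alpha> (Suc (m N))) \<le> 1 / \<delta> * (real (Suc (m N)) * \<alpha> (Suc (m N)))"
    proof (intro always_eventually allI)
      fix N
      have "sqrt (real N) * \<alpha> (Suc (m N)) = 1 / \<delta> * ((\<delta> * sqrt N) * \<alpha> (Suc (m N)))"
        using \<delta>(1) by simp
      also have "\<dots> \<le> 1 / \<delta> * (real (Suc (m N)) * \<alpha> (Suc (m N)))"
        using m2 \<alpha>_nonneg \<delta>(1) by (intro mult_left_mono mult_right_mono) auto
      finally show "norm (sqrt (real N) * \<alpha> (Suc (m N))) \<le> 1 / \<delta> * (real (Suc (m N)) * \<alpha> (Suc (m N)))"
        using \<alpha>_nonneg by simp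
    qed
    show "(\<lambda>N. 1 / \<delta> * (real (Suc (m N)) * \<alpha> (Suc (m N)))) \<longlonglongrightarrow> 0"
      by (intro tendsto_mult_right_zero filterlim_compose[OF _ mlim]
          decseq_summable_times_tendsto_0 decseq_\<alpha> summable_\<alpha> \<alpha>_nonneg)
  qed
  define b where "b N = 32 * K * (sqrt N * \<alpha> (Suc (m N))) + c * (2 * \<delta> + 1 / sqrt N)
    + \<bar>t\<bar> * (\<bar>expectation (\<lambda>\<omega>. (S N \<omega>)\<^sup>2) / N - v\<bar> + 8 * K\<^sup>2 * (\<Sum>d. \<alpha> (d + Suc (m N))))" for N :: nat
  have isq: "(\<lambda>N. 1 / sqrt (real N)) \<longlonglongrightarrow> 0"
    by real_asymp
  have "b \<longlonglongrightarrow> 32 * K * 0 + c * (2 * \<delta> + 0) + \<bar>t\<bar> * (\<bar>v - v\<bar> + 8 * K\<^sup>2 * 0)"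
    unfolding b_def by (intro tendsto_intros \<alpha>0 isq tail V)
  then have "\<forall>\<^sub>F N in sequentially. b N < e"
    using \<delta>(2) by (intro order_tendstoD(2)) (auto simp: mult_ac)
  then show ?thesis
    using eventually_gt_at_top[of 0]
  proof eventually_elim
    case (elim N)
    have "(2 * real (m N) + 1) / sqrt N \<le> 2 * \<delta> + 1 / sqrt N"
      using m1[of N] elim(2) by (simp add: field_simps)
    from mult_left_mono[OF this c] have "err v N (m N) t \<le> b N"
      unfolding err_def b_def c_def by (simp add: algebra_simps)
    then show ?case
      using elim(1) by (intro exI[of _ "m N"]) simp
  qed
qed

lemma \<phi>_tendsto:
  assumes V: "(\<lambda>N. expectation (\<lambda>\<omega>. (S N \<omega>)\<^sup>2) / N) \<longlonglongrightarrow> v" and v: "0 \<le> v"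
  shows "(\<lambda>N. \<phi> N t) \<longlonglongrightarrow> exp (- (v * t\<^sup>2) / 2)"
proof (rule tendstoI)
  fix e :: real assume e: "0 < e"
  \<comment> \<open>The exponential factors of the integrating factor cancel at the end and leave e'
    |t|; the 1 in the denominator covers t = 0.\<close>
  define e' where "e' = e / (\<bar>t\<bar> + 1)"
  have e': "0 < e'" "e' * \<bar>t\<bar> < e"
    using e by (auto simp: e'_def field_simps)
  show "\<forall>\<^sub>F N in sequentially. dist (\<phi> N t) (complex_of_real (exp (- (v * t\<^sup>2) / 2))) < e"
    using err_small[OF V e'(1), of t] eventually_gt_at_top[of 0]
  proof eventually_elim
    case (elim N)
    then obtain m where m: "err v N m t < e'"
      by blast
    \<comment> \<open>Integrating factor for the equation \<open>f' = - t v f\<close>.\<close>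
    define \<psi> where "\<psi> s = exp (v * s\<^sup>2 / 2) *\<^sub>R \<phi> N s" for s
    define \<psi>' where "\<psi>' s = exp (v * s\<^sup>2 / 2) *\<^sub>R (\<phi>' N s + s * v * \<phi> N s)" for s
    have d: "(\<psi> has_vector_derivative \<psi>' s) (at s within A)" for s A
      unfolding \<psi>_def \<psi>'_def
      by (rule derivative_eq_intros \<phi>_has_vector_derivative refl | simp)+
        (simp add: algebra_simps scaleR_conv_of_real)
    \<comment> \<open>Mean value inequality on the segment: the derivative of \<psi> is the
      integrating factor times the defect of the differential equation, both largest at the
      endpoint.\<close>
    have "norm (\<psi> t - \<psi> 0) \<le> (exp (v * t\<^sup>2 / 2) * e') * norm (t - 0)"
    proof (rule differentiable_bound[where S="closed_segment 0 t" and f'="\<lambda>s h. h *\<^sub>R \<psi>' s"])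
      fix s assume "s \<in> closed_segment 0 t"
      then have s: "\<bar>s\<bar> \<le> \<bar>t\<bar>"
        by (auto simp: closed_segment_eq_real_ivl split: if_splits)
      have "norm (\<psi>' s) \<le> exp (v * s\<^sup>2 / 2) * err v N m s"
        using \<phi>'_approx[OF elim(2), of s v m] by (simp add: \<psi>'_def)
      also have "\<dots> \<le> exp (v * t\<^sup>2 / 2) * e'"
        using err_mono[OF s, of v N m] m s v e'(1)
        by (intro mult_mono') (auto simp: abs_le_square_iff mult_left_mono intro: order_trans[OF norm_ge_zero \<phi>'_approx[OF elim(2)]])
      finally show "onorm (\<lambda>h. h *\<^sub>R \<psi>' s) \<le> exp (v * t\<^sup>2 / 2) * e'"
        by (intro onorm_le) (simp add: mult.commute mult_left_mono)
    qed (use d in \<open>auto simp: has_vector_derivative_def\<close>)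
    moreover have "\<psi> 0 = 1"
      by (simp add: \<psi>_def \<phi>_def prob_space)
    moreover have "\<phi> N t - exp (- (v * t\<^sup>2) / 2) = exp (- (v * t\<^sup>2) / 2) *\<^sub>R (\<psi> t - 1)"
      by (simp add: \<psi>_def algebra_simps scaleR_conv_of_real flip: exp_add of_real_mult)
    ultimately have "norm (\<phi> N t - exp (- (v * t\<^sup>2) / 2)) \<le> exp (- (v * t\<^sup>2) / 2) * (exp (v * t\<^sup>2 / 2) * e' * \<bar>t\<bar>)"
      by simp
    also have "\<dots> = e' * \<bar>t\<bar>"
      by (simp flip: exp_add mult.assoc)
    finally show ?case
      using e'(2) by (simp add: dist_norm)
  qed
qed

text \<open>The reindexing \<open>r\<close> is there to pass to the even numbers 2n. Levy's
  continuity theorem reduces the claim to \<open>\<phi>_tendsto\<close>; v \<ge> 0 holds as a limit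
  of second moments.\<close>

theorem central_limit_mixing:
  assumes V: "(\<lambda>N. expectation (\<lambda>\<omega>. (S N \<omega>)\<^sup>2) / N) \<longlonglongrightarrow> v" and r: "filterlim r at_top sequentially"
  shows "weak_conv_m (\<lambda>n. distr M borel (\<lambda>\<omega>. S (r n) \<omega> / sqrt (r n))) (centred_gaussian v)"
proof (rule levy_continuity)
  have v: "0 \<le> v"
    by (rule LIMSEQ_le_const[OF V]) (auto intro!: exI[of _ 0] divide_nonneg_nonneg)
  show "real_distribution (centred_gaussian v)"
    by (rule real_distribution_centred_gaussian[OF v])
  show "real_distribution (distr M borel (\<lambda>\<omega>. S (r n) \<omega> / sqrt (r n)))" for n
    by simp
  have "char (distr M borel (\<lambda>\<omega>. S (r n) \<omega> / sqrt (r n))) t = \<phi> (r n) t" for n t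
    unfolding char_def \<phi>_def by (subst integral_distr) auto
  then show "(\<lambda>n. char (distr M borel (\<lambda>\<omega>. S (r n) \<omega> / sqrt (r n))) t) \<longlonglongrightarrow> char (centred_gaussian v) t" for t
    using filterlim_compose[OF \<phi>_tendsto[OF V v] r] by (simp add: char_centred_gaussian[OF v])
qed

end

section \<open>A strong law for finite-range dependent sequences\<close>

lemma (in prob_space) strong_law_uncorrelated_lag:
  fixes Z :: "nat \<Rightarrow> 'a \<Rightarrow> real"
  assumes meas[measurable]: "\<And>i. Z i \<in> borel_measurable M"
    and bound: "\<And>i \<omega>. \<omega> \<in> space M \<Longrightarrow> \<bar>Z i \<omega>\<bar> \<le> B"
    and uncorr: "\<And>i j. k < nat_dist i j \<Longrightarrow> expectation (\<lambda>\<omega>. Z i \<omega> * Z j \<omega>) = 0"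
  shows "AE \<omega> in M. (\<lambda>n. (\<Sum>i<n. Z i \<omega>) / n) \<longlonglongrightarrow> 0"
proof -
  have B: "0 \<le> B"
    using bound not_empty by (meson abs_ge_zero all_not_in_conv order_trans)
  define D where "D n \<omega> = (\<Sum>i<n. Z i \<omega>)" for n \<omega>
  have [measurable]: "D n \<in> borel_measurable M" for n
    unfolding D_def by measurable
  have bZZ: "\<bar>Z i \<omega> * Z j \<omega>\<bar> \<le> B * B" if "\<omega> \<in> space M" for i j \<omega>
    using bound[OF that] B by (auto simp: abs_mult intro!: mult_mono)
  have iZZ: "integrable M (\<lambda>\<omega>. Z i \<omega> * Z j \<omega>)" for i j
    using bZZ by (auto intro!: integrable_const_bound[where B="B * B"] AE_I2)
  have eZZ: "expectation (\<lambda>\<omega>. Z i \<omega> * Z j \<omega>) \<le> B * B" for i j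
    using integral_mono[OF iZZ, of "\<lambda>_. B * B"] bZZ by (auto simp: prob_space abs_le_iff)
  \<comment> \<open>At most 2k + 1 entries in each row can be nonzero, so the second moment of
    \<open>D n\<close> grows linearly. The average over l^2 terms then has second moment O(1 / l^2),
    which is summable.\<close>
  have D2: "expectation (\<lambda>\<omega>. (D n \<omega>)\<^sup>2) \<le> real n * ((2 * real k + 1) * (B * B))" for n
  proof -
    have "expectation (\<lambda>\<omega>. (D n \<omega>)\<^sup>2) = (\<Sum>j<n. \<Sum>i<n. expectation (\<lambda>\<omega>. Z j \<omega> * Z i \<omega>))"
      unfolding D_def power2_eq_square sum_product by (simp add: iZZ)
    also have "\<dots> \<le> (\<Sum>j<n. \<Sum>i<n. if nat_dist i j \<le> k then B * B else 0)"
      using eZZ uncorr by (intro sum_mono) (auto simp: nat_dist_commute)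
    also have "\<dots> = (\<Sum>j<n. real (card {i. i < n \<and> nat_dist i j \<le> k}) * (B * B))"
      by (simp add: sum.If_cases lessThan_def Int_def)
    also have "\<dots> \<le> (\<Sum>j<n. real (2 * k + 1) * (B * B))"
      using B by (intro sum_mono mult_right_mono of_nat_mono card_nat_dist_le) auto
    finally show ?thesis
      by (simp add: algebra_simps)
  qed
  have iD: "integrable M (\<lambda>\<omega>. (D n \<omega>)\<^sup>2)" for n
    unfolding D_def power2_eq_square sum_product by (simp add: iZZ)
  define R where "R l \<omega> = (D (Suc l ^ 2) \<omega> / real (Suc l ^ 2))\<^sup>2" for l \<omega>
  have R[measurable]: "R l \<in> borel_measurable M" for l
    unfolding R_def by measurable
  \<comment> \<open>Borel--Cantelli along the squares; boundedness fills the gaps.\<close>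
  have eR: "(\<integral>\<^sup>+\<omega>. R l \<omega> \<partial>M) \<le> ennreal ((2 * real k + 1) * (B * B) * (1 / real (Suc l) ^ 2))" for l
  proof -
    have "integrable M (R l)"
      unfolding R_def power_divide using iD by simp
    then have "(\<integral>\<^sup>+\<omega>. R l \<omega> \<partial>M) = ennreal (expectation (R l))"
      by (intro nn_integral_eq_integral AE_I2, assumption) (simp add: R_def)
    moreover have "expectation (R l) = expectation (\<lambda>\<omega>. (D (Suc l ^ 2) \<omega>)\<^sup>2) / (real (Suc l ^ 2))\<^sup>2"
      unfolding R_def power_divide by simp
    moreover have "\<dots> \<le> (real (Suc l ^ 2) * ((2 * real k + 1) * (B * B))) / (real (Suc l ^ 2))\<^sup>2"
      by (intro divide_right_mono D2) auto
    moreover have "\<dots> = (2 * real k + 1) * (B * B) * (1 / real (Suc l) ^ 2)"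
    proof -
      have "x * c / x\<^sup>2 = c * (1 / x)" if "x \<noteq> 0" for x c :: real
        using that by (simp add: power2_eq_square)
      from this[of "real (Suc l ^ 2)" "(2 * real k + 1) * (B * B)"] show ?thesis
        by simp
    qed
    ultimately show ?thesis
      by (simp add: ennreal_leI del: of_nat_Suc)
  qed
  have "summable (\<lambda>l. 1 / real (Suc l) ^ 2)"
    using inverse_power_summable[of 2, where 'a=real] by (subst summable_Suc_iff) (simp add: inverse_eq_divide)
  then have "summable (\<lambda>l. (2 * real k + 1) * (B * B) * (1 / real (Suc l) ^ 2))"
    by (rule summable_mult)
  then have fin: "(\<Sum>l. ennreal ((2 * real k + 1) * (B * B) * (1 / real (Suc l) ^ 2))) < \<infinity>"
    using B by (subst suminf_ennreal2) auto
  have "(\<integral>\<^sup>+\<omega>. (\<Sum>l. ennreal (R l \<omega>)) \<partial>M) = (\<Sum>l. \<integral>\<^sup>+\<omega>. R l \<omega> \<partial>M)"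
    by (rule nn_integral_suminf) measurable
  also have "\<dots> \<le> (\<Sum>l. ennreal ((2 * real k + 1) * (B * B) * (1 / real (Suc l) ^ 2)))"
    using eR by (intro suminf_le) auto
  finally have "(\<integral>\<^sup>+\<omega>. (\<Sum>l. ennreal (R l \<omega>)) \<partial>M) \<noteq> \<infinity>"
    using fin by (auto simp: top_unique)
  then have "AE \<omega> in M. (\<Sum>l. ennreal (R l \<omega>)) \<noteq> \<infinity>"
    by (intro nn_integral_PInf_AE) auto
  then show ?thesis
    using AE_space
  proof eventually_elim
    case (elim \<omega>)
    have "summable (\<lambda>l. R l \<omega>)"
      using elim(1) by (intro summable_suminf_not_top) (auto simp: R_def)
    then have "(\<lambda>l. sqrt (R l \<omega>)) \<longlonglongrightarrow> sqrt 0"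
      by (intro tendsto_real_sqrt summable_LIMSEQ_zero)
    then have sq0: "(\<lambda>l. \<bar>D (Suc l ^ 2) \<omega>\<bar> / real (Suc l ^ 2)) \<longlonglongrightarrow> 0"
      by (simp add: R_def abs_divide del: of_nat_Suc)
    \<comment> \<open>The integer square root: at most 2l terms separate l^2 from n, so they
      contribute at most 2lB, which after division by l^2 is 2B / l.\<close>
    define l where "l n = nat \<lfloor>sqrt (real n)\<rfloor>" for n
    have l1: "l n * l n \<le> n" and l2: "n \<le> l n * l n + 2 * l n" for n
    proof -
      have a: "real (l n) \<le> sqrt n" "sqrt n < real (l n) + 1"
        by (auto simp: l_def) 
      from mult_mono[OF a(1) a(1)] have "real (l n * l n) \<le> real n"
        by simp
      then show "l n * l n \<le> n"
        by (simp only: of_nat_le_iff)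
      have "sqrt n * sqrt n < (real (l n) + 1) * (real (l n) + 1)"
        using a by (intro mult_strict_mono) auto
      then have "real n < real ((l n + 1) * (l n + 1))"
        by (simp add: algebra_simps)
      then have "n < (l n + 1) * (l n + 1)"
        by (simp only: of_nat_less_iff)
      then show "n \<le> l n * l n + 2 * l n"
        by simp
    qed
    have llim: "filterlim l at_top sequentially"
      unfolding l_def
      by (intro filterlim_compose[OF filterlim_nat_sequentially] filterlim_compose[OF filterlim_floor_sequentially]
          filterlim_compose[OF sqrt_at_top] filterlim_real_sequentially)
    have l0: "l n > 0" if "n > 0" for n
      using l2[of n] that by (cases "l n") auto
    have "(\<lambda>l. \<bar>D (l ^ 2) \<omega>\<bar> / real (l ^ 2)) \<longlonglongrightarrow> 0"
      using sq0 by (rule LIMSEQ_imp_Suc)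
    from filterlim_compose[OF this llim]
    have 1: "(\<lambda>n. \<bar>D (l n ^ 2) \<omega>\<bar> / real (l n ^ 2)) \<longlonglongrightarrow> 0" .
    have 2: "(\<lambda>n. 2 * B * (1 / real (l n))) \<longlonglongrightarrow> 0"
      by (intro tendsto_mult_right_zero filterlim_compose[OF lim_1_over_n llim])
    have "(\<lambda>n. D n \<omega> / n) \<longlonglongrightarrow> 0"
    proof (rule Lim_null_comparison)
      show "(\<lambda>n. \<bar>D (l n ^ 2) \<omega>\<bar> / real (l n ^ 2) + 2 * B * (1 / real (l n))) \<longlonglongrightarrow> 0"
        using tendsto_add[OF 1 2] by simp
      show "\<forall>\<^sub>F n in sequentially. norm (D n \<omega> / n) \<le> \<bar>D (l n ^ 2) \<omega>\<bar> / real (l n ^ 2) + 2 * B * (1 / real (l n))"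
        using eventually_gt_at_top[of 0]
      proof eventually_elim
        case n: (elim n)
        have "D n \<omega> = D (l n ^ 2) \<omega> + (\<Sum>i=l n ^ 2..<n. Z i \<omega>)"
          unfolding D_def using l1[of n] sum.atLeastLessThan_concat[of 0 "l n ^ 2" n "\<lambda>i. Z i \<omega>"]
          by (simp only: lessThan_atLeast0 power2_eq_square)
        moreover have "\<bar>\<Sum>i=l n ^ 2..<n. Z i \<omega>\<bar> \<le> (\<Sum>i=l n ^ 2..<n. B)"
          using bound[OF elim(2)] by (intro order_trans[OF sum_abs sum_mono]) auto
        moreover have "\<dots> \<le> real (2 * l n) * B"
          using l2[of n] B by (auto simp: power2_eq_square intro!: mult_right_mono simp del: of_nat_mult)
        ultimately have "\<bar>D n \<omega>\<bar> \<le> \<bar>D (l n ^ 2) \<omega>\<bar> + 2 * real (l n) * B"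
          by simp
        then have "\<bar>D n \<omega>\<bar> / n \<le> (\<bar>D (l n ^ 2) \<omega>\<bar> + 2 * real (l n) * B) / n"
          by (intro divide_right_mono) auto
        also have "\<dots> \<le> (\<bar>D (l n ^ 2) \<omega>\<bar> + 2 * real (l n) * B) / real (l n ^ 2)"
          using l1[of n] l0[OF n] B n by (intro divide_left_mono add_nonneg_nonneg mult_pos_pos of_nat_mono)
            (auto simp: power2_eq_square simp del: of_nat_mult)
        also have "\<dots> = \<bar>D (l n ^ 2) \<omega>\<bar> / real (l n ^ 2) + 2 * B * (1 / real (l n))"
          using l0[OF n] by (simp add: add_divide_distrib power2_eq_square)
        finally show ?case
          by simp
      qed
    qed
    then show ?case
      by (simp add: D_def)
  qed
qed

section \<open>Averages along independent samples\<close>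

lemma indep_vars_PiM_coordinates:
  assumes "prob_space \<mu>" "I \<noteq> {}"
  shows "prob_space.indep_vars (PiM I (\<lambda>_. \<mu>)) (\<lambda>_. \<mu>) (\<lambda>i s. s i) I"
proof -
  interpret P: prob_space "PiM I (\<lambda>_. \<mu>)"
    using assms by (intro prob_space_PiM)
  have "distr (PiM I (\<lambda>_. \<mu>)) (PiM I (\<lambda>_. \<mu>)) (\<lambda>s. \<lambda>i\<in>I. s i) = distr (PiM I (\<lambda>_. \<mu>)) (PiM I (\<lambda>_. \<mu>)) (\<lambda>s. s)"
    by (intro distr_cong) (auto simp: space_PiM restrict_def PiE_def extensional_def)
  also have "\<dots> = PiM I (\<lambda>_. \<mu>)"
    by (rule distr_id)
  also have "\<dots> = PiM I (\<lambda>i. distr (PiM I (\<lambda>_. \<mu>)) \<mu> (\<lambda>s. s i))"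
    using assms(1) by (intro PiM_cong refl distr_PiM_component[symmetric]) auto
  finally show ?thesis
    using assms(2) by (subst P.indep_vars_iff_distr_eq_PiM') auto
qed

lemma distr_PiM_pair:
  assumes \<mu>: "prob_space \<mu>" and ij: "i \<in> I" "j \<in> I" "i \<noteq> j"
  shows "distr (PiM I (\<lambda>_. \<mu>)) (\<mu> \<Otimes>\<^sub>M \<mu>) (\<lambda>s. (s i, s j)) = \<mu> \<Otimes>\<^sub>M \<mu>"
proof -
  interpret P: prob_space "PiM I (\<lambda>_. \<mu>)"
    using \<mu> by (intro prob_space_PiM)
  have "P.indep_var (PiM {i} (\<lambda>_. \<mu>)) (\<lambda>s. \<lambda>l\<in>{i}. s l) (PiM {j} (\<lambda>_. \<mu>)) (\<lambda>s. \<lambda>l\<in>{j}. s l)"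
    using ij by (intro P.indep_var_restrict[OF indep_vars_PiM_coordinates[OF \<mu>]]) auto
  then have "P.indep_var \<mu> ((\<lambda>s. s i) \<circ> (\<lambda>s. \<lambda>l\<in>{i}. s l)) \<mu> ((\<lambda>s. s j) \<circ> (\<lambda>s. \<lambda>l\<in>{j}. s l))"
    by (rule P.indep_var_compose) auto
  then have "P.indep_var \<mu> (\<lambda>s. s i) \<mu> (\<lambda>s. s j)"
    by (simp add: comp_def)
  moreover have "distr (PiM I (\<lambda>_. \<mu>)) \<mu> (\<lambda>s. s l) = \<mu>" if "l \<in> I" for l
    using distr_PiM_component[of I "\<lambda>_. \<mu>" l] \<mu> that by simp
  ultimately show ?thesis
    using ij by (simp add: P.indep_var_distribution_eq)
qed

text \<open>The i-th and j-th terms read disjoint pairs of coordinates once |i - j| > k, hence are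
  independent. The mean is a parameter because k = 0 integrates over the diagonal and k \<ge> 1 over
  the product measure.\<close>

lemma strong_law_PiM_lag:
  fixes h :: "'b \<Rightarrow> 'b \<Rightarrow> real"
  assumes \<mu>: "prob_space \<mu>" and I: "\<And>i. Suc i \<in> I"
    and h[measurable]: "case_prod h \<in> borel_measurable (\<mu> \<Otimes>\<^sub>M \<mu>)"
    and bound: "\<And>x y. x \<in> space \<mu> \<Longrightarrow> y \<in> space \<mu> \<Longrightarrow> \<bar>h x y\<bar> \<le> B"
    and mean: "\<And>i. (\<integral>s. h (s (Suc i)) (s (Suc i + k)) \<partial>PiM I (\<lambda>_. \<mu>)) = c"
  shows "AE s in PiM I (\<lambda>_. \<mu>). (\<lambda>n. (\<Sum>i<n. h (s (Suc i)) (s (Suc i + k))) / n) \<longlonglongrightarrow> c"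
proof -
  let ?P = "PiM I (\<lambda>_. \<mu>)"
  interpret P: prob_space ?P
    using \<mu> by (intro prob_space_PiM)
  have [measurable]: "(\<lambda>s. s (Suc i)) \<in> measurable ?P \<mu>" "(\<lambda>s. s (Suc i + k)) \<in> measurable ?P \<mu>" for i
    using I[of i] I[of "i + k"] by auto
  define Z where "Z i s = h (s (Suc i)) (s (Suc i + k)) - c" for i and s :: "nat \<Rightarrow> 'b"
  have [measurable]: "Z i \<in> borel_measurable ?P" for i
    unfolding Z_def by measurable
  have hb: "\<bar>h (s (Suc i)) (s (Suc i + k))\<bar> \<le> B" if "s \<in> space ?P" for s i
    using that by (intro bound) (auto simp: space_PiM PiE_iff intro: I I[of "_ + _"])
  have Zb: "\<bar>Z i s\<bar> \<le> B + \<bar>c\<bar>" if "s \<in> space ?P" for s i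
    unfolding Z_def using hb[OF that, of i] by simp
  have iZ: "integrable ?P (Z i)" for i
    using Zb by (intro P.integrable_const_bound[where B="B + \<bar>c\<bar>"] AE_I2) auto
  have "integrable ?P (\<lambda>s. h (s (Suc i)) (s (Suc i + k)))" for i
    using hb by (intro P.integrable_const_bound[where B=B] AE_I2) auto
  then have EZ: "P.expectation (Z i) = 0" for i
    using mean[of i] by (simp add: Z_def[abs_def] P.prob_space)
  have "AE s in ?P. (\<lambda>n. (\<Sum>i<n. Z i s) / n) \<longlonglongrightarrow> 0"
  proof (rule P.strong_law_uncorrelated_lag[where k=k])
    fix i j assume ij: "k < nat_dist i j"
    define J where "J i = {Suc i, Suc i + k}" for i
    define Y where "Y i s = h (s (Suc i)) (s (Suc i + k)) - c" for i and s :: "nat \<Rightarrow> 'b"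
    have YZ: "Y i \<circ> (\<lambda>s. \<lambda>l\<in>J i. s l) = Z i" for i
      by (auto simp: Y_def Z_def J_def fun_eq_iff)
    have [measurable]: "(\<lambda>s. s (Suc i)) \<in> measurable (PiM (J i) (\<lambda>_. \<mu>)) \<mu>"
      "(\<lambda>s. s (Suc i + k)) \<in> measurable (PiM (J i) (\<lambda>_. \<mu>)) \<mu>" for i
      by (auto simp: J_def intro!: measurable_component_singleton)
    have [measurable]: "Y i \<in> borel_measurable (PiM (J i) (\<lambda>_. \<mu>))" for i
      unfolding Y_def by measurable
    have "P.indep_var (PiM (J i) (\<lambda>_. \<mu>)) (\<lambda>s. \<lambda>l\<in>J i. s l) (PiM (J j) (\<lambda>_. \<mu>)) (\<lambda>s. \<lambda>l\<in>J j. s l)"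
      using ij by (intro P.indep_var_restrict[OF indep_vars_PiM_coordinates[OF \<mu>]]) (use I I[of "_ + k"] in \<open>auto simp: J_def nat_dist_def\<close>)
    then have "P.indep_var borel (Y i \<circ> (\<lambda>s. \<lambda>l\<in>J i. s l)) borel (Y j \<circ> (\<lambda>s. \<lambda>l\<in>J j. s l))"
      by (rule P.indep_var_compose) auto
    then show "P.expectation (\<lambda>s. Z i s * Z j s) = 0"
      unfolding YZ by (subst P.indep_var_lebesgue_integral[OF _ iZ iZ]) (auto simp: EZ)
  qed (use Zb in auto)
  then show ?thesis
  proof eventually_elim
    case (elim s)
    have "(\<lambda>n. (\<Sum>i<n. Z i s) / n + c) \<longlonglongrightarrow> 0 + c"
      by (intro tendsto_intros elim)
    moreover have "\<forall>\<^sub>F n in sequentially. (\<Sum>i<n. Z i s) / n + c = (\<Sum>i<n. h (s (Suc i)) (s (Suc i + k))) / n"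
      using eventually_gt_at_top[of 0]
      by eventually_elim (auto simp: Z_def sum_subtractf diff_divide_distrib)
    ultimately show ?case
      by (simp add: tendsto_cong)
  qed
qed

text \<open>Sums a symmetric matrix by diagonals. In the induction the new last column adds exactly
  one entry to each diagonal.\<close>

lemma sum_symmetric_square:
  fixes f :: "nat \<Rightarrow> nat \<Rightarrow> real"
  assumes sym: "\<And>i j. f i j = f j i"
  shows "(\<Sum>i<n. \<Sum>j<n. f i j) = (\<Sum>i<n. f i i) + 2 * (\<Sum>k<n. \<Sum>i<n - Suc k. f i (i + Suc k))"
proof (induction n)
  case (Suc n)
  have "(\<Sum>k<Suc n. \<Sum>i<Suc n - Suc k. f i (i + Suc k)) = (\<Sum>k<n. \<Sum>i<Suc (n - Suc k). f i (i + Suc k))"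
    by (auto intro!: sum.cong simp: Suc_diff_Suc)
  also have "\<dots> = (\<Sum>k<n. (\<Sum>i<n - Suc k. f i (i + Suc k)) + f (n - Suc k) n)"
    by (intro sum.cong) auto
  also have "\<dots> = (\<Sum>k<n. \<Sum>i<n - Suc k. f i (i + Suc k)) + (\<Sum>i<n. f i n)"
    using sum.nat_diff_reindex[of "\<lambda>i. f i n" n] by (simp add: sum.distrib)
  finally have *: "(\<Sum>k<Suc n. \<Sum>i<Suc n - Suc k. f i (i + Suc k))
      = (\<Sum>k<n. \<Sum>i<n - Suc k. f i (i + Suc k)) + (\<Sum>i<n. f i n)" .
  have "(\<Sum>i<Suc n. \<Sum>j<Suc n. f i j) = (\<Sum>i<n. \<Sum>j<n. f i j) + (\<Sum>i<n. f i n) + (\<Sum>j<n. f n j) + f n n"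
    by (simp add: sum.distrib)
  also have "(\<Sum>j<n. f n j) = (\<Sum>i<n. f i n)"
    by (intro sum.cong refl sym)
  finally show ?case
    unfolding * Suc.IH by simp
qed simp

text \<open>Of the first n indices only n - k start a pair at lag k, while the normalisation is by n
  + 1, the zero at index 0 being counted. Neither change affects the limit.\<close>

lemma average_shift_tendsto:
  fixes f :: "nat \<Rightarrow> real"
  assumes "(\<lambda>n. (\<Sum>i<n. f i) / n) \<longlonglongrightarrow> c"
  shows "(\<lambda>n. (\<Sum>i<n - k. f i) / Suc n) \<longlonglongrightarrow> c"
proof (rule LIMSEQ_offset[of _ k])
  have "(\<lambda>n. (\<Sum>i<n. f i) / n * (real n / (real n + real k + 1))) \<longlonglongrightarrow> c * 1"
    by (intro tendsto_mult assms) real_asymp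
  moreover have "(\<Sum>i<n. f i) / n * (real n / (real n + real k + 1)) = (\<Sum>i<n + k - k. f i) / Suc (n + k)" for n
    by (cases "n = 0") (auto simp: algebra_simps)
  ultimately show "(\<lambda>n. (\<Sum>i<n + k - k. f i) / Suc (n + k)) \<longlonglongrightarrow> c"
    by simp
qed

lemma (in prob_space) indep_vars_imp_indep_var:
  assumes ind: "indep_vars N X I" and ij: "i \<in> I" "j \<in> I" "i \<noteq> j"
  shows "indep_var (N i) (X i) (N j) (X j)"
proof -
  have "indep_var (PiM {i} N) (\<lambda>\<omega>. \<lambda>l\<in>{i}. X l \<omega>) (PiM {j} N) (\<lambda>\<omega>. \<lambda>l\<in>{j}. X l \<omega>)"
    using ij by (intro indep_var_restrict[OF ind]) auto
  then have "indep_var (N i) ((\<lambda>s. s i) \<circ> (\<lambda>\<omega>. \<lambda>l\<in>{i}. X l \<omega>)) (N j) ((\<lambda>s. s j) \<circ> (\<lambda>\<omega>. \<lambda>l\<in>{j}. X l \<omega>))"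
    by (rule indep_var_compose) auto
  then show ?thesis
    by (simp add: comp_def)
qed

text \<open>Fubini's theorem on the joint law: \<open>X\<close> is frozen while \<open>Y\<close> is
  integrated out. This is how sample points are held fixed under the expectation over the
  process.\<close>

lemma (in prob_space) integral_indep_var:
  fixes h :: "'b \<Rightarrow> 'b \<Rightarrow> real"
  assumes ind: "indep_var A X B Y"
    and h[measurable]: "case_prod h \<in> borel_measurable (A \<Otimes>\<^sub>M B)"
    and bound: "\<And>x y. x \<in> space A \<Longrightarrow> y \<in> space B \<Longrightarrow> \<bar>h x y\<bar> \<le> C"
  shows "expectation (\<lambda>\<omega>. h (X \<omega>) (Y \<omega>)) = (\<integral>x. expectation (\<lambda>\<omega>. h x (Y \<omega>)) \<partial>distr M A X)"
proof -
  have [measurable]: "X \<in> measurable M A" "Y \<in> measurable M B"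
    using indep_var_rv1[OF ind] indep_var_rv2[OF ind] by auto
  interpret A: prob_space "distr M A X"
    by (rule prob_space_distr) simp
  interpret B: prob_space "distr M B Y"
    by (rule prob_space_distr) simp
  interpret AB: pair_prob_space "distr M A X" "distr M B Y" ..
  have "expectation (\<lambda>\<omega>. h (X \<omega>) (Y \<omega>)) = (\<integral>z. case_prod h z \<partial>distr M (A \<Otimes>\<^sub>M B) (\<lambda>\<omega>. (X \<omega>, Y \<omega>)))"
    by (subst integral_distr) auto
  also have "\<dots> = (\<integral>z. case_prod h z \<partial>(distr M A X \<Otimes>\<^sub>M distr M B Y))"
    using ind by (simp add: indep_var_distribution_eq)
  also have "\<dots> = (\<integral>x. \<integral>y. h x y \<partial>distr M B Y \<partial>distr M A X)"
    using bound by (subst AB.integral_fst'[symmetric])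
      (auto intro!: AB.integrable_const_bound[where B=C] AE_I2 simp: space_pair_measure)
  also have "\<dots> = (\<integral>x. expectation (\<lambda>\<omega>. h x (Y \<omega>)) \<partial>distr M A X)"
    by (intro Bochner_Integration.integral_cong refl integral_distr) auto
  finally show ?thesis .
qed

section \<open>The sampled process\<close>

lemma space_Rplus [simp]: "space Rplus = {0..}"
  by (simp add: space_restrict_space)

lemma measurable_RplusD: "f \<in> measurable N Rplus \<Longrightarrow> f \<in> borel_measurable N"
  by (simp add: measurable_restrict_space2_iff)

locale sampled_mixing_process = prob_space M for M :: "'a measure" +
  fixes \<mu> :: "real measure" and \<nu> :: "real measure" and \<xi> :: "nat \<Rightarrow> 'a \<Rightarrow> real"
    and V U U' :: "'a \<Rightarrow> real" and g :: "real \<Rightarrow> real \<Rightarrow> real"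
  assumes prob_\<mu>: "prob_space \<mu>" and sets_\<mu>[measurable_cong]: "sets \<mu> = sets Rplus"
    and V[measurable]: "V \<in> measurable M Rplus" and distr_V: "distr M Rplus V = \<nu>"
    and U[measurable]: "U \<in> measurable M Rplus" and distr_U: "distr M Rplus U = \<mu>"
    and U'[measurable]: "U' \<in> measurable M Rplus" and distr_U': "distr M Rplus U' = \<mu>"
    and indep_VUU': "indep_vars (\<lambda>_. Rplus) (\<lambda>i. [V, U, U'] ! i) {..<3}"
    and indep_UU'_\<xi>: "indep_set
           {(\<lambda>\<omega>. (U \<omega>, U' \<omega>)) -` B \<inter> space M | B. B \<in> sets (Rplus \<Otimes>\<^sub>M Rplus)}
           (generated_sigma M \<xi> {1..})"
    and \<xi>[measurable]: "\<And>l. l \<ge> 1 \<Longrightarrow> \<xi> l \<in> measurable M Rplus"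
    and distr_\<xi>: "\<And>l. l \<ge> 1 \<Longrightarrow> distr M Rplus (\<xi> l) = \<nu>"
    and stationary: "\<And>l k \<tau>. l \<ge> 1 \<Longrightarrow> k \<ge> 1 \<Longrightarrow> \<tau> \<ge> 1 \<Longrightarrow>
           distr M (Rplus \<Otimes>\<^sub>M Rplus) (\<lambda>\<omega>. (\<xi> l \<omega>, \<xi> k \<omega>)) =
           distr M (Rplus \<Otimes>\<^sub>M Rplus) (\<lambda>\<omega>. (\<xi> (l + \<tau>) \<omega>, \<xi> (k + \<tau>) \<omega>))"
    and summable_mixing: "summable (\<lambda>n. mixing_coeff M \<xi> (Suc n))"
    and g: "(\<lambda>(x, y). g x y) \<in> measurable (Rplus \<Otimes>\<^sub>M Rplus) Rplus"
    and bounded_g: "bounded ((\<lambda>(x, y). g x y) ` ({0..} \<times> {0..}))"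
begin

abbreviation \<alpha> :: "nat \<Rightarrow> real" where
  "\<alpha> \<equiv> mixing_coeff M \<xi>"

abbreviation G :: "real \<Rightarrow> real \<Rightarrow> real" where
  "G \<equiv> centred M V g"

text \<open>Index 0 is cut out because nothing is known about \<open>\<xi> 0\<close>. Thus
  \<open>F {0}\<close> is trivial, yet it measures the constant placed at index 0 of the
  sequence.\<close>

definition F :: "nat set \<Rightarrow> 'a measure" where
  "F I = sigma (space M) (\<Union>l\<in>I \<inter> {1..}. {\<xi> l -` B \<inter> space M | B. B \<in> sets Rplus})"

lemma sets_F: "sets (F I) = generated_sigma M \<xi> (I \<inter> {1..})"
  unfolding F_def generated_sigma_def by (subst sets_measure_of) auto

lemma space_F: "space (F I) = space M"
  unfolding F_def by (rule space_measure_of) auto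

lemma subalgebra_F: "subalgebra M (F I)"
proof -
  have "generated_sigma M \<xi> (I \<inter> {1..}) \<subseteq> sets M"
    unfolding generated_sigma_def by (rule sets.sigma_sets_subset) (auto intro: measurable_sets[OF \<xi>])
  then show ?thesis
    by (simp add: subalgebra_def sets_F space_F)
qed

lemma F_mono: "I \<subseteq> J \<Longrightarrow> sets (F I) \<subseteq> sets (F J)"
  unfolding sets_F generated_sigma_def by (intro sigma_sets_mono') auto

lemma \<xi>_F: "l \<ge> 1 \<Longrightarrow> \<xi> l \<in> measurable (F {l}) Rplus"
proof (rule measurableI)
  assume l: "l \<ge> 1"
  have sp: "space (F {l}) = space M"
    by (rule space_F)
  show "\<xi> l \<omega> \<in> space Rplus" if "\<omega> \<in> space (F {l})" for \<omega>
    using measurable_space[OF \<xi>[OF l]] that sp by simp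
  show "\<xi> l -` A \<inter> space (F {l}) \<in> sets (F {l})" if "A \<in> sets Rplus" for A
    unfolding sp sets_F generated_sigma_def using that l by (intro sigma_sets.Basic) auto
qed

lemma mixing_coeff_bdd:
  "bdd_above {\<bar>prob (A \<inter> B) - prob A * prob B\<bar> | k A B. k \<ge> 1
     \<and> A \<in> generated_sigma M \<xi> {1..k} \<and> B \<in> generated_sigma M \<xi> {k + n..}}"
proof (rule bdd_aboveI[of _ 1])
  have "\<bar>prob (A \<inter> B) - prob A * prob B\<bar> \<le> 1" for A B
  proof -
    have "prob A * prob B \<le> 1"
      by (intro mult_le_one) auto
    moreover have "0 \<le> prob A * prob B"
      by simp
    ultimately show ?thesis
      using prob_le_1[of "A \<inter> B"] measure_nonneg[of M "A \<inter> B"] by linarith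
  qed
  then show "x \<le> 1" if "x \<in> {\<bar>prob (A \<inter> B) - prob A * prob B\<bar> | k A B. k \<ge> 1
     \<and> A \<in> generated_sigma M \<xi> {1..k} \<and> B \<in> generated_sigma M \<xi> {k + n..}}" for x
    using that by auto
qed

lemma mixing_coeff_upper:
  "k \<ge> 1 \<Longrightarrow> A \<in> generated_sigma M \<xi> {1..k} \<Longrightarrow> B \<in> generated_sigma M \<xi> {k + n..}
    \<Longrightarrow> \<bar>prob (A \<inter> B) - prob A * prob B\<bar> \<le> \<alpha> n"
  unfolding mixing_coeff_def by (rule cSup_upper[OF _ mixing_coeff_bdd]) blast

lemma empty_in_generated_sigma: "{} \<in> generated_sigma M \<xi> I"
  unfolding generated_sigma_def by (rule sigma_sets.Empty)

lemma mixing_coeff_nonneg: "0 \<le> \<alpha> n"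
  using mixing_coeff_upper[OF le_refl empty_in_generated_sigma empty_in_generated_sigma] by (simp add: abs_le_iff)

text \<open>A larger gap leaves a smaller future sigma-algebra, so the supremum runs over fewer
  events.\<close>

lemma decseq_mixing_coeff: "decseq \<alpha>"
proof (rule decseq_SucI)
  fix n
  show "\<alpha> (Suc n) \<le> \<alpha> n"
    unfolding mixing_coeff_def
  proof (rule cSup_subset_mono[OF _ mixing_coeff_bdd])
    have "generated_sigma M \<xi> {k + Suc n..} \<subseteq> generated_sigma M \<xi> {k + n..}" for k
      unfolding generated_sigma_def by (intro sigma_sets_mono' UN_mono) auto
    then show "{\<bar>prob (A \<inter> B) - prob A * prob B\<bar> | k A B. k \<ge> 1
        \<and> A \<in> generated_sigma M \<xi> {1..k} \<and> B \<in> generated_sigma M \<xi> {k + Suc n..}}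
      \<subseteq> {\<bar>prob (A \<inter> B) - prob A * prob B\<bar> | k A B. k \<ge> 1
        \<and> A \<in> generated_sigma M \<xi> {1..k} \<and> B \<in> generated_sigma M \<xi> {k + n..}}"
      by blast
  qed (use empty_in_generated_sigma in blast)
qed

lemma mixing_le_F: "mixing_le (F {..k}) (F {k + n..}) (\<alpha> n)"
  unfolding mixing_le_def
proof (intro conjI subalgebra_F ballI)
  fix A B assume AB: "A \<in> sets (F {..k})" "B \<in> sets (F {k + n..})"
  show "\<bar>prob (A \<inter> B) - prob A * prob B\<bar> \<le> \<alpha> n"
  proof (cases "k = 0")
    \<comment> \<open>The supremum defining the coefficient starts at k = 1, but for k = 0 the past
      is trivial and its events are independent of everything.\<close>
    case True
    then have "A \<in> sigma_sets (space M) {}"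
      using AB(1) by (simp add: sets_F generated_sigma_def)
    then have "A = {} \<or> A = space M"
      by (simp add: sigma_sets_empty_eq)
    moreover have "B \<subseteq> space M"
      using sets.sets_into_space[OF AB(2)] by (simp add: space_F)
    ultimately show ?thesis
      using mixing_coeff_nonneg by (auto simp: prob_space Int_absorb1)
  next
    case False
    then have "{..k} \<inter> {1..} = {1..k}" "{k + n..} \<inter> {1..} = {k + n..}"
      by auto
    then show ?thesis
      using AB False by (intro mixing_coeff_upper) (auto simp: sets_F)
  qed
qed

text \<open>Twice a bound of g, because centring can double the size: \<open>K / 2\<close> bounds g
  and \<open>K\<close> bounds its centred version.\<close>

definition K :: real where
  "K = 2 * (SOME b. \<forall>x\<ge>0. \<forall>y\<ge>0. \<bar>g x y\<bar> \<le> b)"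

lemma g_bound: "x \<ge> 0 \<Longrightarrow> y \<ge> 0 \<Longrightarrow> \<bar>g x y\<bar> \<le> K / 2"
proof -
  have "\<exists>b. \<forall>x\<ge>0. \<forall>y\<ge>0. \<bar>g x y\<bar> \<le> b"
    using bounded_g by (force simp: bounded_iff)
  from someI_ex[OF this] show "x \<ge> 0 \<Longrightarrow> y \<ge> 0 \<Longrightarrow> \<bar>g x y\<bar> \<le> K / 2"
    by (simp add: K_def)
qed

lemma K_nonneg: "0 \<le> K"
  using g_bound[of 0 0] abs_ge_zero[of "g 0 0"] by linarith

lemma g_meas[measurable]: "case_prod g \<in> borel_measurable (Rplus \<Otimes>\<^sub>M Rplus)"
  using measurable_RplusD[OF g] .

lemma V_nonneg: "\<omega> \<in> space M \<Longrightarrow> 0 \<le> V \<omega>"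
  using measurable_space[OF V] by simp

lemma \<xi>_nonneg: "l \<ge> 1 \<Longrightarrow> \<omega> \<in> space M \<Longrightarrow> 0 \<le> \<xi> l \<omega>"
  using measurable_space[OF \<xi>] by simp

lemma G_bound: "x \<ge> 0 \<Longrightarrow> y \<ge> 0 \<Longrightarrow> \<bar>G x y\<bar> \<le> K"
proof -
  assume xy: "x \<ge> 0" "y \<ge> 0"
  have "\<bar>\<integral>\<omega>. g (V \<omega>) y \<partial>M\<bar> \<le> (\<integral>\<omega>. \<bar>g (V \<omega>) y\<bar> \<partial>M)"
    by (rule integral_abs_bound)
  also have "\<dots> \<le> (\<integral>\<omega>. K / 2 \<partial>M)"
    using g_bound V_nonneg xy K_nonneg by (intro integral_mono') auto
  finally show ?thesis
    using g_bound[OF xy] by (simp add: centred_def prob_space)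
qed

lemma G_meas[measurable]: "case_prod G \<in> borel_measurable (Rplus \<Otimes>\<^sub>M Rplus)"
proof -
  have "(\<lambda>y. \<integral>\<omega>. g (V \<omega>) y \<partial>M) \<in> borel_measurable Rplus"
    by (rule borel_measurable_lebesgue_integral) measurable
  then show ?thesis
    unfolding centred_def by measurable
qed

lemma G_meas1: "y \<ge> 0 \<Longrightarrow> (\<lambda>x. G x y) \<in> borel_measurable Rplus"
  using measurable_Pair2[OF G_meas]
  by (intro measurable_compose[OF _ G_meas, of "\<lambda>x. (x, y)", simplified]) (auto intro!: measurable_Pair)

text \<open>Centring is done with \<open>V\<close>, and every \<open>\<xi> l\<close> shares its
  law.\<close>

lemma G_mean: "l \<ge> 1 \<Longrightarrow> y \<ge> 0 \<Longrightarrow> (\<integral>\<omega>. G (\<xi> l \<omega>) y \<partial>M) = 0"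
proof -
  assume l: "l \<ge> 1" and y: "y \<ge> 0"
  have gy[measurable]: "(\<lambda>x. g x y) \<in> borel_measurable Rplus"
    using y by (intro measurable_compose[OF _ g_meas, of "\<lambda>x. (x, y)", simplified]) (auto intro!: measurable_Pair)
  note [measurable] = \<xi>[OF l]
  have "(\<integral>\<omega>. g (\<xi> l \<omega>) y \<partial>M) = (\<integral>x. g x y \<partial>distr M Rplus (\<xi> l))"
    by (simp add: integral_distr)
  also have "\<dots> = (\<integral>x. g x y \<partial>distr M Rplus V)"
    by (simp add: distr_\<xi>[OF l] distr_V)
  also have "\<dots> = (\<integral>\<omega>. g (V \<omega>) y \<partial>M)"
    by (simp add: integral_distr)
  moreover have "integrable M (\<lambda>\<omega>. g (\<xi> l \<omega>) y)"
    using g_bound \<xi>_nonneg l y by (intro integrable_const_bound[where B="K/2"]) (auto intro!: AE_I2)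
  ultimately show ?thesis
    by (simp add: centred_def prob_space)
qed

text \<open>The zero at index 0 turns the sum over \<open>1..2n-1\<close> of the theorem into one with \<open>2n\<close> terms,
  matching the normalisation \<open>sqrt (2n)\<close>.\<close>

definition X :: "(nat \<Rightarrow> real) \<Rightarrow> nat \<Rightarrow> 'a \<Rightarrow> real" where
  "X s j \<omega> = (if j = 0 then 0 else G (\<xi> j \<omega>) (s j))"

lemma bounded_mixing_sequence_X:
  assumes s: "\<And>j. j \<ge> 1 \<Longrightarrow> 0 \<le> s j"
  shows "bounded_mixing_sequence M (X s) F \<alpha> K"
proof
  show "subalgebra M (F I)" for I
    by (rule subalgebra_F)
  show "I \<subseteq> J \<Longrightarrow> sets (F I) \<subseteq> sets (F J)" for I J
    by (rule F_mono)
  show "X s j \<in> borel_measurable (F {j})" for j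
  proof (cases "j = 0")
    case False
    then show ?thesis
      using measurable_compose[OF \<xi>_F[of j] G_meas1[of "s j"]] s[of j] by (simp add: X_def[abs_def])
  qed (simp add: X_def[abs_def])
  show "\<bar>X s j \<omega>\<bar> \<le> K" if "\<omega> \<in> space M" for j \<omega>
    using G_bound[OF \<xi>_nonneg[OF _ that] s] K_nonneg by (simp add: X_def)
  show "expectation (X s j) = 0" for j
    using G_mean[of j "s j"] s[of j] by (cases "j = 0") (simp_all add: X_def[abs_def])
  show "mixing_le (F {..k}) (F {k + n..}) (\<alpha> n)" for k n
    by (rule mixing_le_F)
  show "decseq \<alpha>"
    by (rule decseq_mixing_coeff)
  show "summable \<alpha>"
    using summable_mixing by (simp add: summable_Suc_iff)
qed

text \<open>The lag-k covariance as a function of the two sample points. Averaged over independent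
  points it gives the k-th covariance of the series for k \<ge> 1; on the diagonal,
  \<open>c 0\<close> gives the variance term.\<close>

definition c :: "nat \<Rightarrow> real \<Rightarrow> real \<Rightarrow> real" where
  "c k u u' = (\<integral>\<omega>. G (\<xi> 1 \<omega>) u * G (\<xi> (1 + k) \<omega>) u' \<partial>M)"

lemma GG_meas: "u \<ge> 0 \<Longrightarrow> u' \<ge> 0 \<Longrightarrow> (\<lambda>z. G (fst z) u * G (snd z) u') \<in> borel_measurable (Rplus \<Otimes>\<^sub>M Rplus)"
  using G_meas1[of u] G_meas1[of u'] by measurable

lemma covariance_shift:
  assumes l: "l \<ge> 1" and u: "u \<ge> 0" "u' \<ge> 0"
  shows "(\<integral>\<omega>. G (\<xi> l \<omega>) u * G (\<xi> (l + k) \<omega>) u' \<partial>M) = c k u u'"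
proof (cases "l = 1")
  \<comment> \<open>Stationarity is available only for shifts of at least 1; here the shift is l -
    1.\<close>
  case False
  have *: "(\<integral>\<omega>. G (\<xi> i \<omega>) u * G (\<xi> j \<omega>) u' \<partial>M)
      = (\<integral>z. G (fst z) u * G (snd z) u' \<partial>distr M (Rplus \<Otimes>\<^sub>M Rplus) (\<lambda>\<omega>. (\<xi> i \<omega>, \<xi> j \<omega>)))"
    if "i \<ge> 1" "j \<ge> 1" for i j
    using \<xi>[OF that(1)] \<xi>[OF that(2)] by (subst integral_distr[OF _ GG_meas[OF u]]) auto
  have "1 + (l - 1) = l" "1 + k + (l - 1) = l + k"
    using l by auto
  then have shift: "distr M (Rplus \<Otimes>\<^sub>M Rplus) (\<lambda>\<omega>. (\<xi> 1 \<omega>, \<xi> (1 + k) \<omega>))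
      = distr M (Rplus \<Otimes>\<^sub>M Rplus) (\<lambda>\<omega>. (\<xi> l \<omega>, \<xi> (l + k) \<omega>))"
    using stationary[of 1 "1 + k" "l - 1"] l False by (simp add: add.commute[of k l])
  show ?thesis
    unfolding c_def using l by (subst (1 2) *) (auto simp only: shift)
qed (simp add: c_def)

lemma expectation_XX:
  assumes s: "\<And>j. j \<ge> 1 \<Longrightarrow> 0 \<le> s j"
  shows "expectation (\<lambda>\<omega>. X s (Suc i) \<omega> * X s (Suc i + k) \<omega>) = c k (s (Suc i)) (s (Suc i + k))"
  using covariance_shift[of "Suc i" "s (Suc i)" "s (Suc i + k)" k] s by (simp add: X_def)

text \<open>The two points are embedded in an artificial sample with value u at index 1 and u'
  elsewhere, so that the covariance bound for mixing sequences applies.\<close>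

lemma c_bound:
  assumes "k \<ge> 1" "u \<ge> 0" "u' \<ge> 0"
  shows "\<bar>c k u u'\<bar> \<le> 4 * K\<^sup>2 * \<alpha> k"
proof -
  define s where "s j = (if j = 1 then u else u')" for j :: nat
  have s: "0 \<le> s j" for j
    using assms by (simp add: s_def)
  interpret S: bounded_mixing_sequence M "X s" F \<alpha> K
    using s by (rule bounded_mixing_sequence_X)
  show ?thesis
    using S.covariance_X_le[of 1 "1 + k"] expectation_XX[of s 0 k] s assms(1)
    by (simp add: s_def nat_dist_def)
qed

lemma c_bound_const:
  assumes "u \<ge> 0" "u' \<ge> 0"
  shows "\<bar>c k u u'\<bar> \<le> K\<^sup>2"
proof -
  have "\<bar>c k u u'\<bar> \<le> (\<integral>\<omega>. \<bar>G (\<xi> 1 \<omega>) u * G (\<xi> (1 + k) \<omega>) u'\<bar> \<partial>M)"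
    unfolding c_def by (rule integral_abs_bound)
  also have "\<dots> \<le> (\<integral>\<omega>. K\<^sup>2 \<partial>M)"
    using G_bound \<xi>_nonneg assms K_nonneg
    by (intro integral_mono') (auto simp: abs_mult power2_eq_square intro!: mult_mono)
  finally show ?thesis
    by (simp add: prob_space)
qed

lemma c_meas[measurable]: "case_prod (c k) \<in> borel_measurable (\<mu> \<Otimes>\<^sub>M \<mu>)"
proof -
  note [measurable] = \<xi>[of 1] \<xi>[of "1 + k"]
  show ?thesis
    unfolding c_def by measurable
qed

lemma space_\<mu>: "space \<mu> = {0..}"
  using sets_eq_imp_space_eq[OF sets_\<mu>] by simp

lemma indep_var_UU'_\<xi>\<xi>:
  assumes "i \<ge> 1" "j \<ge> 1"
  shows "indep_var (Rplus \<Otimes>\<^sub>M Rplus) (\<lambda>\<omega>. (U \<omega>, U' \<omega>)) (Rplus \<Otimes>\<^sub>M Rplus) (\<lambda>\<omega>. (\<xi> i \<omega>, \<xi> j \<omega>))"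
proof -
  note [measurable] = \<xi>[OF assms(1)] \<xi>[OF assms(2)]
  let ?Y = "\<lambda>\<omega>. (\<xi> i \<omega>, \<xi> j \<omega>)" and ?U = "\<lambda>\<omega>. (U \<omega>, U' \<omega>)"
  \<comment> \<open>Preimages under one map already form a sigma-algebra, so the generated
    sigma-algebras in the definition of independence collapse to the families in the
    hypothesis.\<close>
  have gen: "sigma_sets (space M) {f -` A \<inter> space M | A. A \<in> sets N} = {f -` A \<inter> space M | A. A \<in> sets N}"
    if "f \<in> measurable M N" for f :: "'a \<Rightarrow> real \<times> real" and N
    using sets_vimage_algebra[of "space M" f N] sets_vimage_algebra2[of f "space M" N] measurable_space[OF that]
    by auto
  have "\<xi> i \<in> measurable (F {i, j}) Rplus" "\<xi> j \<in> measurable (F {i, j}) Rplus"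
    using \<xi>_F[of i] \<xi>_F[of j] F_mono[of "{i}" "{i, j}"] F_mono[of "{j}" "{i, j}"] assms
    by (auto simp: measurable_def space_F)
  then have "?Y \<in> measurable (F {i, j}) (Rplus \<Otimes>\<^sub>M Rplus)"
    by measurable
  then have "{?Y -` A \<inter> space M | A. A \<in> sets (Rplus \<Otimes>\<^sub>M Rplus)} \<subseteq> sets (F {i, j})"
    by (auto dest: measurable_sets simp: space_F)
  also have "\<dots> \<subseteq> sets (F {1..})"
    using assms by (intro F_mono) auto
  finally have sub: "{?Y -` A \<inter> space M | A. A \<in> sets (Rplus \<Otimes>\<^sub>M Rplus)} \<subseteq> generated_sigma M \<xi> {1..}"
    by (simp add: sets_F)
  have "indep_set {?U -` A \<inter> space M | A. A \<in> sets (Rplus \<Otimes>\<^sub>M Rplus)} {?Y -` A \<inter> space M | A. A \<in> sets (Rplus \<Otimes>\<^sub>M Rplus)}"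
    using indep_UU'_\<xi> sub unfolding indep_sets2_eq by blast
  then show ?thesis
    unfolding indep_var_eq by (subst (1 2) gen) auto
qed

section \<open>Integration of the covariances over the sample points\<close>

lemma distr_UU': "distr M (Rplus \<Otimes>\<^sub>M Rplus) (\<lambda>\<omega>. (U \<omega>, U' \<omega>)) = \<mu> \<Otimes>\<^sub>M \<mu>"
  using indep_vars_imp_indep_var[OF indep_VUU', of 1 2]
  by (simp add: indep_var_distribution_eq distr_U distr_U' numeral_2_eq_2)

text \<open>Independence from the process allows the pair (U, U') to be frozen, and its law is the
  product of \<mu> with itself.\<close>

lemma rho_cov_eq: "rho_cov M V U U' \<xi> g k = (\<integral>z. c k (fst z) (snd z) \<partial>(\<mu> \<Otimes>\<^sub>M \<mu>))"
proof -
  let ?h = "\<lambda>z w. G (fst w) (fst z) * G (snd w) (snd z)"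
  have "rho_cov M V U U' \<xi> g k = expectation (\<lambda>\<omega>. ?h (U \<omega>, U' \<omega>) (\<xi> 1 \<omega>, \<xi> (1 + k) \<omega>))"
    by (simp add: rho_cov_def)
  also have "\<dots> = (\<integral>z. expectation (\<lambda>\<omega>. ?h z (\<xi> 1 \<omega>, \<xi> (1 + k) \<omega>)) \<partial>distr M (Rplus \<Otimes>\<^sub>M Rplus) (\<lambda>\<omega>. (U \<omega>, U' \<omega>)))"
  proof (rule integral_indep_var[OF indep_var_UU'_\<xi>\<xi>])
    show "\<bar>?h z w\<bar> \<le> K * K" if "z \<in> space (Rplus \<Otimes>\<^sub>M Rplus)" "w \<in> space (Rplus \<Otimes>\<^sub>M Rplus)" for z w
      using that G_bound K_nonneg by (auto simp: space_pair_measure abs_mult intro!: mult_mono)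
  qed (simp, simp, measurable)
  also have "\<dots> = (\<integral>z. c k (fst z) (snd z) \<partial>(\<mu> \<Otimes>\<^sub>M \<mu>))"
    by (simp add: distr_UU' c_def)
  finally show ?thesis .
qed

text \<open>Once \<open>U\<close> is frozen only the law of \<open>V\<close> matters, so
  \<open>V\<close> may be replaced by \<open>\<xi> 1\<close>; this turns the variance term into a
  lag-0 covariance.\<close>

lemma expectation_G_power2: "expectation (\<lambda>\<omega>. (G (V \<omega>) (U \<omega>))\<^sup>2) = (\<integral>u. c 0 u u \<partial>\<mu>)"
proof -
  have ind: "indep_var Rplus U Rplus V"
    using indep_vars_imp_indep_var[OF indep_VUU', of 1 0] by simp
  have "expectation (\<lambda>\<omega>. (G (V \<omega>) (U \<omega>))\<^sup>2) = (\<integral>u. expectation (\<lambda>\<omega>. (G (V \<omega>) u)\<^sup>2) \<partial>distr M Rplus U)"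
  proof (rule integral_indep_var[OF ind])
    show "\<bar>(G y x)\<^sup>2\<bar> \<le> K\<^sup>2" if "x \<in> space Rplus" "y \<in> space Rplus" for x y
      using power_mono[OF G_bound, of y x 2] that by simp
  qed measurable
  also have "\<dots> = (\<integral>u. c 0 u u \<partial>\<mu>)"
    unfolding distr_U
  proof (intro Bochner_Integration.integral_cong refl)
    fix u assume "u \<in> space \<mu>"
    then have u: "u \<ge> 0"
      by (simp add: space_\<mu>)
    have [measurable]: "(\<lambda>x. G x u) \<in> borel_measurable Rplus"
      by (rule G_meas1[OF u])
    have "expectation (\<lambda>\<omega>. (G (V \<omega>) u)\<^sup>2) = (\<integral>x. (G x u)\<^sup>2 \<partial>distr M Rplus V)"
      by (simp add: integral_distr)
    also have "\<dots> = (\<integral>x. (G x u)\<^sup>2 \<partial>distr M Rplus (\<xi> 1))"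
      by (simp add: distr_V distr_\<xi>)
    also have "\<dots> = c 0 u u"
      using \<xi>[of 1] by (simp add: integral_distr c_def power2_eq_square)
    finally show "expectation (\<lambda>\<omega>. (G (V \<omega>) u)\<^sup>2) = c 0 u u" .
  qed
  finally show ?thesis .
qed

lemma integrable_G_power2: "integrable M (\<lambda>\<omega>. (G (V \<omega>) (U \<omega>))\<^sup>2)"
  using power_mono[OF G_bound, of "V _" "U _" 2] V_nonneg measurable_space[OF U]
  by (intro integrable_const_bound[where B="K\<^sup>2"] AE_I2) auto

lemma integrable_GG: "k \<ge> 1 \<Longrightarrow> integrable M (\<lambda>\<omega>. G (\<xi> 1 \<omega>) (U \<omega>) * G (\<xi> (1 + k) \<omega>) (U' \<omega>))"
proof -
  note [measurable] = \<xi>[of 1] \<xi>[of "1 + k"]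
  show ?thesis
    using G_bound \<xi>_nonneg measurable_space[OF U] measurable_space[OF U'] K_nonneg
    by (intro integrable_const_bound[where B="K * K"] AE_I2) (auto simp: abs_mult intro!: mult_mono)
qed

text \<open>For k = 0 both arguments are the same coordinate, with law \<mu> on the diagonal; for k
  \<ge> 1 they are distinct coordinates, hence independent. The two branches of m are the
  corresponding integrals.\<close>

lemma AE_average_c:
  fixes k :: nat
  assumes "m = (if k = 0 then expectation (\<lambda>\<omega>. (G (V \<omega>) (U \<omega>))\<^sup>2) else rho_cov M V U U' \<xi> g k)"
  shows "AE s in PiM {1..} (\<lambda>_. \<mu>). (\<lambda>n. (\<Sum>i<n. c k (s (Suc i)) (s (Suc i + k))) / n) \<longlonglongrightarrow> m"
proof (rule strong_law_PiM_lag[OF prob_\<mu> _ c_meas])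
  show "\<bar>c k x y\<bar> \<le> K\<^sup>2" if "x \<in> space \<mu>" "y \<in> space \<mu>" for x y
    using that c_bound_const by (simp add: space_\<mu>)
  fix i
  show "(\<integral>s. c k (s (Suc i)) (s (Suc i + k)) \<partial>PiM {1..} (\<lambda>_. \<mu>)) = m"
  proof (cases "k = 0")
    case True
    have "(\<integral>s. c 0 (s (Suc i)) (s (Suc i)) \<partial>PiM {1..} (\<lambda>_. \<mu>))
        = (\<integral>u. c 0 u u \<partial>distr (PiM {1..} (\<lambda>_. \<mu>)) \<mu> (\<lambda>s. s (Suc i)))"
      by (subst integral_distr) auto
    also have "distr (PiM {1..} (\<lambda>_. \<mu>)) \<mu> (\<lambda>s. s (Suc i)) = \<mu>"
      using prob_\<mu> distr_PiM_component[of "{1..}" "\<lambda>_. \<mu>" "Suc i"] by simp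
    finally show ?thesis
      using True assms by (simp add: expectation_G_power2)
  next
    case False
    have "(\<integral>s. c k (s (Suc i)) (s (Suc i + k)) \<partial>PiM {1..} (\<lambda>_. \<mu>))
        = (\<integral>z. c k (fst z) (snd z) \<partial>distr (PiM {1..} (\<lambda>_. \<mu>)) (\<mu> \<Otimes>\<^sub>M \<mu>) (\<lambda>s. (s (Suc i), s (Suc i + k))))"
      by (subst integral_distr) auto
    also have "\<dots> = (\<integral>z. c k (fst z) (snd z) \<partial>(\<mu> \<Otimes>\<^sub>M \<mu>))"
      using False by (subst distr_PiM_pair[OF prob_\<mu>]) auto
    finally show ?thesis
      using False assms by (simp add: rho_cov_eq)
  qed
qed simp

lemma rho_cov_bound: "k \<ge> 1 \<Longrightarrow> \<bar>rho_cov M V U U' \<xi> g k\<bar> \<le> 4 * K\<^sup>2 * \<alpha> k"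
proof -
  assume k: "k \<ge> 1"
  interpret \<mu>: prob_space \<mu>
    by (rule prob_\<mu>)
  interpret \<mu>\<mu>: pair_prob_space \<mu> \<mu> ..
  have "\<bar>rho_cov M V U U' \<xi> g k\<bar> \<le> (\<integral>z. \<bar>c k (fst z) (snd z)\<bar> \<partial>(\<mu> \<Otimes>\<^sub>M \<mu>))"
    unfolding rho_cov_eq by (rule integral_abs_bound)
  also have "\<dots> \<le> (\<integral>z. 4 * K\<^sup>2 * \<alpha> k \<partial>(\<mu> \<Otimes>\<^sub>M \<mu>))"
    using c_bound[OF k] mixing_coeff_nonneg by (intro integral_mono') (auto simp: space_pair_measure space_\<mu>)
  finally show ?thesis
    by (simp add: \<mu>\<mu>.prob_space)
qed

lemma summable_rho_cov: "summable (\<lambda>k. rho_cov M V U U' \<xi> g (Suc k))"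
  by (rule summable_comparison_test'[of "\<lambda>k. 4 * K\<^sup>2 * \<alpha> (Suc k)" 0])
    (use summable_mixing rho_cov_bound in \<open>auto intro: summable_mult\<close>)

lemma variance_tendsto:
  assumes s: "\<And>j. j \<ge> 1 \<Longrightarrow> 0 \<le> s j"
    and lim0: "(\<lambda>n. (\<Sum>i<n. c 0 (s (Suc i)) (s (Suc i + 0))) / n) \<longlonglongrightarrow> expectation (\<lambda>\<omega>. (G (V \<omega>) (U \<omega>))\<^sup>2)"
    and lim: "\<And>k. (\<lambda>n. (\<Sum>i<n. c (Suc k) (s (Suc i)) (s (Suc i + Suc k))) / n) \<longlonglongrightarrow> rho_cov M V U U' \<xi> g (Suc k)"
  shows "(\<lambda>N. expectation (\<lambda>\<omega>. (\<Sum>j<N. X s j \<omega>)\<^sup>2) / N) \<longlonglongrightarrow> rho_sq M V U U' \<xi> g"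
proof -
  interpret S: bounded_mixing_sequence M "X s" F \<alpha> K
    using s by (rule bounded_mixing_sequence_X)
  define e where "e i j = expectation (\<lambda>\<omega>. X s (Suc i) \<omega> * X s (Suc j) \<omega>)" for i j
  have e_sym: "e i j = e j i" for i j
    by (simp add: e_def mult.commute)
  have e: "e i (i + k) = c k (s (Suc i)) (s (Suc i + k))" for i k
    using expectation_XX[of s i k] s by (simp add: e_def)
  \<comment> \<open>The contribution of lag k + 1 to the normalised variance of n + 1 summands, the
    first of which is 0. Truncated subtraction makes it vanish for n \<le> k, so the finite sum over
    lags is a full series in the form required by Tannery's theorem.\<close>
  define a where "a k n = (\<Sum>i<n - Suc k. e i (i + Suc k)) / Suc n" for k n
  have a0: "a k n = 0" if "n \<le> k" for k n
    using that by (simp add: a_def)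
  have V: "expectation (\<lambda>\<omega>. (\<Sum>j<Suc n. X s j \<omega>)\<^sup>2) / Suc n = (\<Sum>i<n. e i i) / Suc n + 2 * (\<Sum>k. a k n)" for n
  proof -
    have "expectation (\<lambda>\<omega>. (\<Sum>j<Suc n. X s j \<omega>)\<^sup>2) = expectation (\<lambda>\<omega>. (\<Sum>i<n. X s (Suc i) \<omega>)\<^sup>2)"
      by (subst sum.lessThan_Suc_shift) (simp add: X_def)
    also have "\<dots> = (\<Sum>i<n. \<Sum>j<n. e i j)"
      unfolding power2_eq_square sum_product e_def by (simp add: S.integrable_XX)
    also have "\<dots> = (\<Sum>i<n. e i i) + 2 * (\<Sum>k<n. \<Sum>i<n - Suc k. e i (i + Suc k))"
      using e_sym by (rule sum_symmetric_square)
    also have "\<dots> / Suc n = (\<Sum>i<n. e i i) / Suc n + 2 * (\<Sum>k<n. a k n)"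
      by (simp add: a_def add_divide_distrib del: of_nat_Suc flip: sum_divide_distrib)
    also have "(\<Sum>k<n. a k n) = (\<Sum>k. a k n)"
      using a0 by (intro suminf_finite[symmetric]) auto
    finally show ?thesis .
  qed
  have "(\<lambda>n. \<Sum>k. a k n) \<longlonglongrightarrow> (\<Sum>k. rho_cov M V U U' \<xi> g (Suc k))"
  proof (intro conjunct2[OF conjunct2[OF tannerys_theorem]])
    show "(\<lambda>n. a k n) \<longlonglongrightarrow> rho_cov M V U U' \<xi> g (Suc k)" for k
      unfolding a_def e by (rule average_shift_tendsto[OF lim])
    show "summable (\<lambda>k. 4 * K\<^sup>2 * \<alpha> (Suc k))"
      using summable_mixing by (rule summable_mult)
    \<comment> \<open>Fewer than n + 1 pairs have this lag, so the average inherits the bound on a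
      single covariance, uniformly in n.\<close>
    have "norm (a k n) \<le> 4 * K\<^sup>2 * \<alpha> (Suc k)" for k n
    proof -
      have "\<bar>\<Sum>i<n - Suc k. e i (i + Suc k)\<bar> \<le> (\<Sum>i<n - Suc k. 4 * K\<^sup>2 * \<alpha> (Suc k))"
        unfolding e using c_bound[of "Suc k"] s by (intro order_trans[OF sum_abs sum_mono]) auto
      also have "\<dots> \<le> real (Suc n) * (4 * K\<^sup>2 * \<alpha> (Suc k))"
        using mixing_coeff_nonneg by (auto intro!: mult_right_mono)
      finally show ?thesis
        by (simp add: a_def abs_divide pos_divide_le_eq mult.commute del: of_nat_Suc)
    qed
    then show "\<forall>\<^sub>F (k, n) in at_top \<times>\<^sub>F sequentially. norm (a k n) \<le> 4 * K\<^sup>2 * \<alpha> (Suc k)"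
      by (intro always_eventually) auto
  qed simp
  moreover have "(\<lambda>n. (\<Sum>i<n. e i i) / Suc n) \<longlonglongrightarrow> expectation (\<lambda>\<omega>. (G (V \<omega>) (U \<omega>))\<^sup>2)"
    using average_shift_tendsto[where k=0, OF lim0] e[of _ 0] by simp
  ultimately have "(\<lambda>n. expectation (\<lambda>\<omega>. (\<Sum>j<Suc n. X s j \<omega>)\<^sup>2) / Suc n) \<longlonglongrightarrow> rho_sq M V U U' \<xi> g"
    unfolding V rho_sq_def by (intro tendsto_intros)
  then show ?thesis
    by (rule LIMSEQ_imp_Suc)
qed

text \<open>One sample outside the null sets of all lags has the right variance limit, and the limit
  theorem then applies to it. Nonnegativity is recorded here because it comes from that
  limit.\<close>

lemma AE_central_limit:
  "AE s in PiM {1..} (\<lambda>_. \<mu>). 0 \<le> rho_sq M V U U' \<xi> g \<and>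
     weak_conv_m
       (\<lambda>n. distr M borel (\<lambda>\<omega>. (\<Sum>j = 1..2 * n - 1. G (\<xi> j \<omega>) (s j)) / sqrt (2 * real n)))
       (centred_gaussian (rho_sq M V U U' \<xi> g))"
proof -
  have "AE s in PiM {1..} (\<lambda>_. \<mu>). \<forall>k. (\<lambda>n. (\<Sum>i<n. c (Suc k) (s (Suc i)) (s (Suc i + Suc k))) / n)
      \<longlonglongrightarrow> rho_cov M V U U' \<xi> g (Suc k)"
    unfolding AE_all_countable using AE_average_c[OF refl, of "Suc _"] by simp
  moreover have "AE s in PiM {1..} (\<lambda>_. \<mu>). (\<lambda>n. (\<Sum>i<n. c 0 (s (Suc i)) (s (Suc i + 0))) / n)
      \<longlonglongrightarrow> expectation (\<lambda>\<omega>. (G (V \<omega>) (U \<omega>))\<^sup>2)"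
    using AE_average_c[OF refl, of 0] by simp
  ultimately show ?thesis
    using AE_space
  proof eventually_elim
    case (elim s)
    have s: "0 \<le> s j" if "j \<ge> 1" for j
      using elim(3) that by (auto simp: space_PiM PiE_iff space_\<mu>)
    interpret S: bounded_mixing_sequence M "X s" F \<alpha> K
      using s by (rule bounded_mixing_sequence_X)
    have V: "(\<lambda>N. expectation (\<lambda>\<omega>. (S.S N \<omega>)\<^sup>2) / N) \<longlonglongrightarrow> rho_sq M V U U' \<xi> g"
      unfolding S.S_def using elim s by (intro variance_tendsto) auto
    have nonneg: "0 \<le> rho_sq M V U U' \<xi> g"
      by (rule LIMSEQ_le_const[OF V]) (auto intro!: exI[of _ 0] divide_nonneg_nonneg)
    have "S.S (2 * n) \<omega> = (\<Sum>j = 1..2 * n - 1. G (\<xi> j \<omega>) (s j))" for n \<omega>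
    proof -
      have "S.S (2 * n) \<omega> = (\<Sum>j\<in>{1..2 * n - 1}. X s j \<omega>)"
        unfolding S.S_def by (intro sum.mono_neutral_right) (auto simp: X_def)
      also have "\<dots> = (\<Sum>j = 1..2 * n - 1. G (\<xi> j \<omega>) (s j))"
        by (intro sum.cong) (auto simp: X_def)
      finally show ?thesis .
    qed
    moreover have "filterlim (\<lambda>n. 2 * n) at_top (sequentially :: nat filter)"
      by (rule filterlim_subseq) (simp add: strict_mono_def)
    ultimately show ?case
      using S.central_limit_mixing[OF V, of "\<lambda>n. 2 * n"] nonneg by simp
  qed
qed

text \<open>The sign is not visible from the series. It holds for almost every sample and does not
  depend on the sample, and a probability measure admits no constant false statement almost
  everywhere.\<close>

lemma rho_sq_nonneg: "0 \<le> rho_sq M V U U' \<xi> g"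
proof -
  interpret P: prob_space "PiM {1::nat..} (\<lambda>_. \<mu>)"
    by (intro prob_space_PiM prob_\<mu>)
  have "AE s in PiM {1::nat..} (\<lambda>_. \<mu>). 0 \<le> rho_sq M V U U' \<xi> g"
    using AE_central_limit by eventually_elim simp
  then show ?thesis
    by simp
qed

end

text \<open>Integrals and infinite sums are total functions in the logic, so finiteness of the
  variance is expressed by integrability of every integrand together with summability of the
  covariances; nonnegativity makes the Gaussian law meaningful.\<close>

theorem theorem1p6:
  fixes M :: "'a measure"
    and \<mu> \<nu> :: "real measure"
    and \<xi> :: "nat \<Rightarrow> 'a \<Rightarrow> real"
    and V U U' :: "'a \<Rightarrow> real"
    and g :: "real \<Rightarrow> real \<Rightarrow> real"
    and p q :: "nat \<Rightarrow> nat"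
  assumes "prob_space M"
    and "prob_space \<mu>" and "sets \<mu> = sets Rplus"
    and "prob_space \<nu>" and "sets \<nu> = sets Rplus"
    and "V \<in> measurable M Rplus" and "distr M Rplus V = \<nu>"
    and "U \<in> measurable M Rplus" and "distr M Rplus U = \<mu>"
    and "U' \<in> measurable M Rplus" and "distr M Rplus U' = \<mu>"
    and "prob_space.indep_vars M (\<lambda>_. Rplus) (\<lambda>i. [V, U, U'] ! i) {..<3}"
    and "prob_space.indep_set M
           {(\<lambda>\<omega>. (U \<omega>, U' \<omega>)) -` B \<inter> space M | B. B \<in> sets (Rplus \<Otimes>\<^sub>M Rplus)}
           (generated_sigma M \<xi> {1..})"
    and "\<And>l. l \<ge> 1 \<Longrightarrow> \<xi> l \<in> measurable M Rplus"
    and "\<And>l. l \<ge> 1 \<Longrightarrow> distr M Rplus (\<xi> l) = \<nu>"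
    and "\<And>l k \<tau>. l \<ge> 1 \<Longrightarrow> k \<ge> 1 \<Longrightarrow> \<tau> \<ge> 1 \<Longrightarrow>
           distr M (Rplus \<Otimes>\<^sub>M Rplus) (\<lambda>\<omega>. (\<xi> l \<omega>, \<xi> k \<omega>)) =
           distr M (Rplus \<Otimes>\<^sub>M Rplus) (\<lambda>\<omega>. (\<xi> (l + \<tau>) \<omega>, \<xi> (k + \<tau>) \<omega>))"
    and "summable (\<lambda>n. mixing_coeff M \<xi> (Suc n))"
    and "\<And>n. n \<ge> 1 \<Longrightarrow> p n \<ge> 1" and "\<And>n. n \<ge> 1 \<Longrightarrow> q n \<ge> 1"
    and "filterlim p at_top sequentially" and "filterlim q at_top sequentially"
    and "(\<lambda>n. real (q n)) \<in> o(\<lambda>n. real (p n))"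
    and "(\<lambda>n. real (p n)) \<in> o(\<lambda>n. real n)"
    and "(\<lambda>n. real n / real (p n) * mixing_coeff M \<xi> (q n)) \<in> o(\<lambda>_. 1)"
    and "(\<lambda>n. real (p n) / real n * (\<Sum>j = 1..p n. real j * mixing_coeff M \<xi> j)) \<in> o(\<lambda>_. 1)"
    and "(\<lambda>(x, y). g x y) \<in> measurable (Rplus \<Otimes>\<^sub>M Rplus) Rplus"
    and "bounded ((\<lambda>(x, y). g x y) ` ({0..} \<times> {0..}))"
  shows "integrable M (\<lambda>\<omega>. (centred M V g (V \<omega>) (U \<omega>))\<^sup>2)
    \<and> (\<forall>k\<ge>1. integrable M
          (\<lambda>\<omega>. centred M V g (\<xi> 1 \<omega>) (U \<omega>) * centred M V g (\<xi> (1 + k) \<omega>) (U' \<omega>)))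
    \<and> summable (\<lambda>k. rho_cov M V U U' \<xi> g (Suc k))
    \<and> 0 \<le> rho_sq M V U U' \<xi> g
    \<and> (AE s in PiM {1..} (\<lambda>_. \<mu>).
          weak_conv_m
            (\<lambda>n. distr M borel
              (\<lambda>\<omega>. (\<Sum>j = 1..2 * n - 1. centred M V g (\<xi> j \<omega>) (s j)) / sqrt (2 * real n)))
            (centred_gaussian (rho_sq M V U U' \<xi> g)))"
proof -
  interpret prob_space M
    by fact
  interpret sampled_mixing_process M \<mu> \<nu> \<xi> V U U' g
    by (intro sampled_mixing_process.intro sampled_mixing_process_axioms.intro; fact)
  show ?thesis
  proof (intro conjI allI impI)
    show "AE s in PiM {1..} (\<lambda>_. \<mu>).
        weak_conv_m
          (\<lambda>n. distr M borel
            (\<lambda>\<omega>. (\<Sum>j = 1..2 * n - 1. centred M V g (\<xi> j \<omega>) (s j)) / sqrt (2 * real n)))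
          (centred_gaussian (rho_sq M V U U' \<xi> g))"
      using AE_central_limit by eventually_elim simp
  qed (rule integrable_G_power2 integrable_GG summable_rho_cov rho_sq_nonneg; assumption?)+
qed

end
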